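(* Let $C$ be a linear code of length $n$ over a finite commutative Frobenius ring $R$. Then $$\mathrm{sse}_{C^\perp}(\mathbf{X})=\frac{1}{|C|}\,\mathrm{sse}_C\big(\mathbf{Q}\mathbf{D}\mathbf{A}^{-1}\mathbf{X}\big),$$ where $\mathbf{Q},\mathbf{D},\mathbf{A}$ are the $(t+1)\times(t+1)$ matrices with rows and columns indexed by $\{0,1,\dots,t\}$ defined as follows: $\mathbf A$ has $(i,j)$ entry $1$ if $a_iR\subseteq a_jR$ and $0$ otherwise; $\mathbf D$ is diagonal with diagonal entries $|a_0R|,\dots,|a_tR|$; and $\mathbf Q$ has $(i,j)$ entry $1$ if $a_jR\subseteq(a_iR)^\perp$ and $0$ otherwise.
   Context: Rings have an identity. A finite commutative ring $R$ is Frobenius if $R/\mathrm{Rad}(R)\cong \mathrm{Soc}(R)$ as $R$-modules. A linear code $C$ of length $n$ over $R$ is an $R$-submodule of $R^n$; $C^\perp=\{\mathbf v\in R^n: \sum_{\ell=1}^n u_\ell v_\ell=0\text{ for all }\mathbf u\in C\}$. For $c\in R$, $cR=\{cb:b\in R\}$, and $(cR)^\perp=\{r\in R: cr=0\}$. Let $[n]=\{1,\dots,n\}$. Let $t$ be the number of nonzero principal ideals of $R$ and let $a_0,\dots,a_t\in R$ be fixed elements such that $a_0R,\dots,a_tR$ are pairwise distinct (hence are all the principal ideals of $R$). For $\mathbf c=(c_1,\dots,c_n)\in R^n$ let $S_i(\mathbf c)=\{\ell\in[n]: c_\ell R=a_iR\}$. $t\cdot[n]$ is the multiset with underlying set $[n]$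 in which each element appears exactly $t$ times. For a multiset $Z\subseteq t\cdot[n]$ and $0\le i\le t$, $M_i(Z)$ is the set of $\ell\in[n]$ with multiplicity exactly $i$ in $Z$. Put $A_C(Z)=|\{\mathbf c\in C: S_i(\mathbf c)=M_i(Z)\text{ for all }i=0,\dots,t\}|$. Let $\mathbf X=(x_{i\ell})$ be a matrix of indeterminates with rows indexed by $\{0,\dots,t\}$ and columns by $[n]$. The symmetrized support enumerator of $C$ is $$\mathrm{sse}_C(\mathbf X)=\sum_{Z\subseteq t\cdot[n]}A_C(Z)\prod_{i=0}^t\prod_{\ell\in M_i(Z)}x_{i\ell}.$$ For a $(t+1)\times(t+1)$ matrix $\mathbf M$, $\mathrm{sse}_C(\mathbf M\mathbf X)$ means substituting the $(i,\ell)$ entry of $\mathbf M\mathbf X$ for $x_{i\ell}$. The matrix $\mathbf A$ (adjacency matrix of the poset of principal ideals under inclusion) is invertible. *)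

theory Defs
  imports
    "HOL-Algebra.QuotRing"
    "HOL-Algebra.Module"
    "HOL-Library.Poly_Mapping"
    "HOL-Library.Multiset"
    "HOL-Library.FuncSet"
    "Jordan_Normal_Form.Gauss_Jordan_Elimination"
    "Jordan_Normal_Form.Determinant"
begin

section \<open>Finite commutative Frobenius rings\<close>

text \<open>The zero ring is not excluded. It has no maximal ideal, so its Jacobson radical is the
  whole ring.\<close>

definition jacobson_radical :: "('a, 'b) ring_scheme \<Rightarrow> 'a set" where
  "jacobson_radical R = {x \<in> carrier R. \<forall>M. maximalideal M R \<longrightarrow> x \<in> M}"

definition minimal_ideal :: "'a set \<Rightarrow> ('a, 'b) ring_scheme \<Rightarrow> bool" where
  "minimal_ideal I R \<longleftrightarrow> ideal I R \<and> I \<noteq> {\<zero>\<^bsub>R\<^esub>} \<and>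
     (\<forall>J. ideal J R \<and> J \<subseteq> I \<longrightarrow> J = {\<zero>\<^bsub>R\<^esub>} \<or> J = I)"

text \<open>The sum of a family of ideals is the ideal generated by their union.\<close>

definition socle :: "('a, 'b) ring_scheme \<Rightarrow> 'a set" where
  "socle R = Idl\<^bsub>R\<^esub> (\<Union>{I. minimal_ideal I R})"

text \<open>Ideals and quotients by ideals as \<open>R\<close>-modules. The record type \<^typ>\<open>('a, 'b) module\<close>
  extends the one of rings; its fields \<^const>\<open>monoid.mult\<close> and \<^const>\<open>one\<close> play no role for modules.\<close>

definition ideal_module :: "('a, 'b) ring_scheme \<Rightarrow> 'a set \<Rightarrow> ('a, 'a) module" where
  "ideal_module R I = \<lparr>carrier = I, monoid.mult = monoid.mult R, one = one R,
     zero = zero R, add = add R, module.smult = monoid.mult R\<rparr>"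

definition quotient_module :: "('a, 'b) ring_scheme \<Rightarrow> 'a set \<Rightarrow> ('a, 'a set) module" where
  "quotient_module R J = \<lparr>carrier = carrier (R Quot J), monoid.mult = monoid.mult (R Quot J),
     one = one (R Quot J), zero = zero (R Quot J), add = add (R Quot J),
     module.smult = (\<lambda>r A. (J +>\<^bsub>R\<^esub> r) \<otimes>\<^bsub>R Quot J\<^esub> A)\<rparr>"

definition module_iso ::
  "('a, 'b) ring_scheme \<Rightarrow> ('a, 'c, 'd) module_scheme \<Rightarrow> ('a, 'e, 'f) module_scheme \<Rightarrow> ('c \<Rightarrow> 'e) set"
where
  "module_iso R M N = {f. bij_betw f (carrier M) (carrier N) \<and>
     (\<forall>x\<in>carrier M. \<forall>y\<in>carrier M. f (x \<oplus>\<^bsub>M\<^esub> y) = f x \<oplus>\<^bsub>N\<^esub> f y) \<and>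
     (\<forall>r\<in>carrier R. \<forall>x\<in>carrier M. f (r \<odot>\<^bsub>M\<^esub> x) = r \<odot>\<^bsub>N\<^esub> f x)}"

definition finite_frobenius_cring :: "('a, 'b) ring_scheme \<Rightarrow> bool" where
  "finite_frobenius_cring R \<longleftrightarrow> cring R \<and> finite (carrier R) \<and>
     module_iso R (quotient_module R (jacobson_radical R)) (ideal_module R (socle R)) \<noteq> {}"


section \<open>Linear codes\<close>

text \<open>\<open>R\<^sup>n\<close> consists of the functions on \<open>{..<n}\<close> with values in \<open>R\<close>; coordinates are counted
  from 0, to match the column indices of matrices.\<close>

definition free_module :: "('a, 'b) ring_scheme \<Rightarrow> nat \<Rightarrow> ('a, nat \<Rightarrow> 'a) module" where
  "free_module R n = \<lparr>carrier = {..<n} \<rightarrow>\<^sub>E carrier R,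
     monoid.mult = (\<lambda>u v. \<lambda>l\<in>{..<n}. u l \<otimes>\<^bsub>R\<^esub> v l), one = (\<lambda>l\<in>{..<n}. \<one>\<^bsub>R\<^esub>),
     zero = (\<lambda>l\<in>{..<n}. \<zero>\<^bsub>R\<^esub>), add = (\<lambda>u v. \<lambda>l\<in>{..<n}. u l \<oplus>\<^bsub>R\<^esub> v l),
     module.smult = (\<lambda>r v. \<lambda>l\<in>{..<n}. r \<otimes>\<^bsub>R\<^esub> v l)\<rparr>"

definition linear_code :: "('a, 'b) ring_scheme \<Rightarrow> nat \<Rightarrow> (nat \<Rightarrow> 'a) set \<Rightarrow> bool" where
  "linear_code R n C \<longleftrightarrow> submodule C R (free_module R n)"

definition dual_code :: "('a, 'b) ring_scheme \<Rightarrow> nat \<Rightarrow> (nat \<Rightarrow> 'a) set \<Rightarrow> (nat \<Rightarrow> 'a) set" where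
  "dual_code R n C = {v \<in> carrier (free_module R n).
     \<forall>u\<in>C. (\<Oplus>\<^bsub>R\<^esub>l\<in>{..<n}. u l \<otimes>\<^bsub>R\<^esub> v l) = \<zero>\<^bsub>R\<^esub>}"


section \<open>Polynomials in the indeterminates \<open>x\<^sub>i\<^sub>l\<close>\<close>

text \<open>A monomial is a finitely supported map from index pairs to exponents, and a polynomial a
  finitely supported map from monomials to coefficients. Multiplication of the outer
  \<^type>\<open>poly_mapping\<close> is convolution, that is, multiplication of polynomials.\<close>

type_synonym 'k mpoly = "(nat \<times> nat \<Rightarrow>\<^sub>0 nat) \<Rightarrow>\<^sub>0 'k"

definition mconst :: "'k::comm_ring_1 \<Rightarrow> 'k mpoly" where
  "mconst c = Poly_Mapping.single 0 c"

definition indet :: "nat \<Rightarrow> nat \<Rightarrow> 'k::comm_ring_1 mpoly" where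
  "indet i l = Poly_Mapping.single (Poly_Mapping.single (i, l) 1) 1"

definition indet_mat :: "nat \<Rightarrow> nat \<Rightarrow> 'k::comm_ring_1 mpoly mat" where
  "indet_mat m n = mat m n (\<lambda>(i, l). indet i l)"

text \<open>The result of replacing every \<open>x\<^sub>i\<^sub>l\<close> in \<open>p\<close> by the \<open>(i, l)\<close> entry of \<open>Y\<close>.\<close>

definition subst_mat :: "'k::comm_ring_1 mpoly \<Rightarrow> 'k mpoly mat \<Rightarrow> 'k mpoly" where
  "subst_mat p Y = (\<Sum>m\<in>Poly_Mapping.keys p. mconst (Poly_Mapping.lookup p m) *
     (\<Prod>v\<in>Poly_Mapping.keys m. (Y $$ v) ^ Poly_Mapping.lookup m v))"


section \<open>The symmetrized support enumerator\<close>

definition num_nonzero_principal_ideals :: "('a, 'b) ring_scheme \<Rightarrow> nat" where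
  "num_nonzero_principal_ideals R =
     card {PIdl\<^bsub>R\<^esub> c | c. c \<in> carrier R \<and> PIdl\<^bsub>R\<^esub> c \<noteq> {\<zero>\<^bsub>R\<^esub>}}"

definition principal_annihilator :: "('a, 'b) ring_scheme \<Rightarrow> 'a \<Rightarrow> 'a set" where
  "principal_annihilator R c = {r \<in> carrier R. c \<otimes>\<^bsub>R\<^esub> r = \<zero>\<^bsub>R\<^esub>}"

definition ideal_support ::
  "('a, 'b) ring_scheme \<Rightarrow> (nat \<Rightarrow> 'a) \<Rightarrow> nat \<Rightarrow> nat \<Rightarrow> (nat \<Rightarrow> 'a) \<Rightarrow> nat set" where
  "ideal_support R a n i c = {l \<in> {..<n}. PIdl\<^bsub>R\<^esub> (c l) = PIdl\<^bsub>R\<^esub> (a i)}"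

definition mult_level :: "nat \<Rightarrow> nat \<Rightarrow> nat multiset \<Rightarrow> nat set" where
  "mult_level n i Z = {l \<in> {..<n}. count Z l = i}"

definition support_count ::
  "('a, 'b) ring_scheme \<Rightarrow> (nat \<Rightarrow> 'a) \<Rightarrow> nat \<Rightarrow> nat \<Rightarrow> (nat \<Rightarrow> 'a) set \<Rightarrow> nat multiset \<Rightarrow> nat" where
  "support_count R a t n C Z =
     card {c \<in> C. \<forall>i\<in>{0..t}. ideal_support R a n i c = mult_level n i Z}"

definition sse ::
  "('a, 'b) ring_scheme \<Rightarrow> (nat \<Rightarrow> 'a) \<Rightarrow> nat \<Rightarrow> nat \<Rightarrow> (nat \<Rightarrow> 'a) set \<Rightarrow> 'k::comm_ring_1 mpoly" where
  "sse R a t n C = (\<Sum>Z\<in>{Z. Z \<subseteq># repeat_mset t (mset_set {..<n})}.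
     of_nat (support_count R a t n C Z) * (\<Prod>i\<in>{0..t}. \<Prod>l\<in>mult_level n i Z. indet i l))"


section \<open>The matrices\<close>

definition inclusion_mat ::
  "('a, 'b) ring_scheme \<Rightarrow> (nat \<Rightarrow> 'a) \<Rightarrow> nat \<Rightarrow> 'k::field mat" where
  "inclusion_mat R a t = mat (t + 1) (t + 1)
     (\<lambda>(i, j). if PIdl\<^bsub>R\<^esub> (a i) \<subseteq> PIdl\<^bsub>R\<^esub> (a j) then 1 else 0)"

definition card_mat :: "('a, 'b) ring_scheme \<Rightarrow> (nat \<Rightarrow> 'a) \<Rightarrow> nat \<Rightarrow> 'k::field mat" where
  "card_mat R a t = mat (t + 1) (t + 1)
     (\<lambda>(i, j). if i = j then of_nat (card (PIdl\<^bsub>R\<^esub> (a i))) else 0)"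

definition annihilator_mat ::
  "('a, 'b) ring_scheme \<Rightarrow> (nat \<Rightarrow> 'a) \<Rightarrow> nat \<Rightarrow> 'k::field mat" where
  "annihilator_mat R a t = mat (t + 1) (t + 1)
     (\<lambda>(i, j). if PIdl\<^bsub>R\<^esub> (a j) \<subseteq> principal_annihilator R (a i) then 1 else 0)"

text \<open>\<^const>\<open>mat_inverse\<close> returns an option; the lemma below shows that in the case of
  \<^const>\<open>inclusion_mat\<close> there always is a value.\<close>

definition inclusion_mat_inv ::
  "('a, 'b) ring_scheme \<Rightarrow> (nat \<Rightarrow> 'a) \<Rightarrow> nat \<Rightarrow> 'k::field mat" where
  "inclusion_mat_inv R a t = the (mat_inverse (inclusion_mat R a t))"

lemma inclusion_mat_inv:
  fixes a :: "nat \<Rightarrow> 'a"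
  assumes inj: "inj_on (\<lambda>i. PIdl\<^bsub>R\<^esub> (a i)) {0..t}"
  defines "A \<equiv> inclusion_mat R a t :: 'k::field mat"
    and "B \<equiv> inclusion_mat_inv R a t :: 'k mat"
  shows "B \<in> carrier_mat (t + 1) (t + 1)" "A * B = 1\<^sub>m (t + 1)" "B * A = 1\<^sub>m (t + 1)"
proof -
  let ?I = "\<lambda>i. PIdl\<^bsub>R\<^esub> (a i)"
  have A: "A \<in> carrier_mat (t + 1) (t + 1)"
    by (simp add: A_def inclusion_mat_def)
  have "det A \<noteq> 0"
  proof
    assume "det A = 0"
    then obtain v where v: "v \<in> carrier_vec (t + 1)" "v \<noteq> 0\<^sub>v (t + 1)" "A *\<^sub>v v = 0\<^sub>v (t + 1)"
      using det_0_iff_vec_prod_zero[OF A] by blast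
    let ?N = "{i. i < t + 1 \<and> v $ i \<noteq> 0}"
    have "?N \<noteq> {}"
      using v(1,2) by (auto simp: vec_eq_iff)
    then obtain P where P: "P \<in> ?I ` ?N" and max: "\<And>P'. P' \<in> ?I ` ?N \<Longrightarrow> P \<subseteq> P' \<Longrightarrow> P = P'"
      using finite_has_maximal[of "?I ` ?N"] by auto
    from P obtain i where i: "i < t + 1" "v $ i \<noteq> 0" "P = ?I i" by auto
    have *: "(if ?I i \<subseteq> ?I j then 1 else 0) * v $ j = (if j = i then v $ i else 0)"
      if j: "j < t + 1" for j
    proof (cases "v $ j = 0 \<or> \<not> ?I i \<subseteq> ?I j")
      case True
      then show ?thesis using i by auto
    next
      case False
      then have "?I i = ?I j" using max[of "?I j"] i j by auto
      then have "j = i" using inj i j by (auto simp: inj_on_def)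
      then show ?thesis by simp
    qed
    have "(A *\<^sub>v v) $ i = (\<Sum>j = 0..<t + 1. (if ?I i \<subseteq> ?I j then 1 else 0) * v $ j)"
      using i(1) v(1) by (auto simp: A_def inclusion_mat_def scalar_prod_def intro!: sum.cong)
    also have "\<dots> = (\<Sum>j = 0..<t + 1. if j = i then v $ i else 0)"
      by (intro sum.cong refl *) simp
    also have "\<dots> = v $ i"
      using i(1) by (subst sum.delta) auto
    finally show False using v(3) i by simp
  qed
  then have "A \<in> Units (ring_mat TYPE('k) (t + 1) ())"
    by (rule det_non_zero_imp_unit[OF A])
  then have "mat_inverse A = Some B"
    using mat_inverse(1)[OF A, where b = "()"] unfolding B_def inclusion_mat_inv_def A_def
    by (cases "mat_inverse (inclusion_mat R a t :: 'k mat)") auto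
  from mat_inverse(2)[OF A this]
  show "B \<in> carrier_mat (t + 1) (t + 1)" "A * B = 1\<^sub>m (t + 1)" "B * A = 1\<^sub>m (t + 1)"
    by auto
qed

end

theory Submission
  imports Defs
begin

text \<open>
  In the variables \<open>Y = A\<inverse> X\<close> the enumerator of \<open>C\<^sup>\<bottom>\<close> has as coefficients the numbers
  \<open>\<bar>C\<^sup>\<bottom> \<inter> D\<bar>\<close>, where \<open>D\<close> runs over the products \<open>I\<^sub>1 \<times> \<dots> \<times> I\<^sub>n\<close> of principal ideals, and
  the enumerator of \<open>C\<close> at \<open>Q D A\<inverse> X\<close> has the coefficients \<open>\<bar>D\<bar> \<bar>C \<inter> D\<^sup>\<bottom>\<bar>\<close>. So the theorem
  amounts to \<open>\<bar>C\<^sup>\<bottom> \<inter> D\<bar> \<bar>C\<bar> = \<bar>D\<bar> \<bar>C \<inter> D\<^sup>\<bottom>\<bar>\<close>.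

  This needs no generating character. If \<open>K \<subset> K + R x\<close> and \<open>P = {s. s x \<in> K}\<close> is a maximal
  ideal, then \<open>v \<mapsto> x \<cdot> v\<close> embeds \<open>(D \<inter> K\<^sup>\<bottom>) / (D \<inter> (K + R x)\<^sup>\<bottom>)\<close> into the annihilator of
  \<open>P\<close>, which over a Frobenius ring has at most \<open>\<bar>R/P\<bar> = \<bar>(K + R x)/K\<bar>\<close> elements. Hence
  \<open>\<bar>D \<inter> K\<^sup>\<bottom>\<bar> \<bar>K\<bar>\<close> increases with \<open>K\<close>. Comparing \<open>K = C \<inter> D\<^sup>\<bottom>\<close> with \<open>K = C\<close> gives one
  inequality, and exchanging the roles of \<open>C\<close> and \<open>D\<close> gives the other.
\<close>

section \<open>Annihilators of maximal ideals\<close>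

lemma (in ring) jacobson_radical_ideal: "ideal (jacobson_radical R) R"
proof -
  \<comment> \<open>\<open>carrier R\<close> is inserted because the zero ring has no maximal ideals
    and \<open>i_Intersect\<close> wants a nonempty family.\<close>
  have "jacobson_radical R = \<Inter> (insert (carrier R) {M. maximalideal M R})"
    by (auto simp: jacobson_radical_def)
  also have "ideal \<dots> R"
    by (rule i_Intersect) (auto simp: oneideal maximalideal.axioms(1))
  finally show ?thesis .
qed

text \<open>Maximal ideals are prime, so each of them that contains a square contains its
  root.\<close>

lemma (in cring) jacobson_radical_square:
  assumes "x \<in> carrier R" "x \<otimes> x \<in> jacobson_radical R"
  shows "x \<in> jacobson_radical R"
proof -
  have "x \<in> M" if "maximalideal M R" for M
  proof -
    interpret primeideal M R by (rule maximalideal_prime[OF that])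
    have "x \<otimes> x \<in> M" using assms that by (auto simp: jacobson_radical_def)
    then show ?thesis using I_prime assms by blast
  qed
  then show ?thesis using assms by (auto simp: jacobson_radical_def)
qed

lemma (in ring) minimal_ideal_subset_socle:
  assumes "minimal_ideal I R"
  shows "I \<subseteq> socle R"
proof -
  have "\<Union>{I. minimal_ideal I R} \<subseteq> carrier R"
    by (auto simp: minimal_ideal_def dest: ideal.Icarr)
  then show ?thesis
    unfolding socle_def using genideal_self assms by blast
qed

lemma (in ring) socle_subset: "socle R \<subseteq> carrier R"
proof -
  have "\<Union>{I. minimal_ideal I R} \<subseteq> carrier R"
    by (auto simp: minimal_ideal_def dest: ideal.Icarr)
  from genideal_ideal[OF this] show ?thesis
    unfolding socle_def by (auto dest: ideal.Icarr)
qed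

text \<open>Composing the isomorphism with the projection \<open>R -> R/J\<close> gives a surjection
  from \<open>R\<close> itself onto the socle with kernel \<open>J\<close>, so that later arguments
  compute with elements instead of cosets.\<close>

lemma frobenius_socle_map:
  fixes R (structure)
  assumes "finite_frobenius_cring R"
  obtains \<phi> where "\<phi> ` carrier R = socle R"
    and "\<And>r x. \<lbrakk>r \<in> carrier R; x \<in> carrier R\<rbrakk> \<Longrightarrow> \<phi> (r \<otimes> x) = r \<otimes> \<phi> x"
    and "\<And>x y. \<lbrakk>x \<in> carrier R; y \<in> carrier R\<rbrakk> \<Longrightarrow> \<phi> (x \<oplus> y) = \<phi> x \<oplus> \<phi> y"
    and "\<And>x. x \<in> carrier R \<Longrightarrow> \<phi> x = \<zero> \<longleftrightarrow> x \<in> jacobson_radical R"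
proof -
  interpret cring R using assms by (simp add: finite_frobenius_cring_def)
  let ?J = "jacobson_radical R"
  interpret J: ideal ?J R by (rule jacobson_radical_ideal)
  obtain f where f: "f \<in> module_iso R (quotient_module R ?J) (ideal_module R (socle R))"
    using assms by (auto simp: finite_frobenius_cring_def)
  have cos: "carrier (R Quot ?J) = (\<lambda>x. ?J +> x) ` carrier R"
    by (auto simp: FactRing_simps)
  have bij: "bij_betw f ((\<lambda>x. ?J +> x) ` carrier R) (socle R)"
    using f cos by (simp add: module_iso_def quotient_module_def ideal_module_def)
  have add: "f (?J +> (x \<oplus> y)) = f (?J +> x) \<oplus> f (?J +> y)"
    if "x \<in> carrier R" "y \<in> carrier R" for x y
    using f cos that
    by (auto simp: module_iso_def quotient_module_def ideal_module_def FactRing_def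
        simp flip: J.a_rcos_sum)
  have mult: "f (?J +> (r \<otimes> x)) = r \<otimes> f (?J +> x)"
    if "r \<in> carrier R" "x \<in> carrier R" for r x
    using f cos that
    by (auto simp: module_iso_def quotient_module_def ideal_module_def FactRing_def
        simp flip: J.rcoset_mult_add)
  have img: "(\<lambda>x. f (?J +> x)) ` carrier R = socle R"
    using bij by (auto simp: bij_betw_def image_image)
  \<comment> \<open>Preservation of zero is not among the conditions of \<open>module_iso\<close>;
    it follows by scaling with \<open>\<zero>\<close>.\<close>
  have zero: "f (?J +> \<zero>) = \<zero>"
  proof -
    have "f (?J +> \<zero>) \<in> carrier R" using img socle_subset by auto
    then show ?thesis using mult[of \<zero> \<zero>] by simp
  qed
  have ker: "f (?J +> x) = \<zero> \<longleftrightarrow> x \<in> ?J" if x: "x \<in> carrier R" for x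
  proof -
    have "f (?J +> x) = \<zero> \<longleftrightarrow> ?J +> x = ?J +> \<zero>"
      using bij x zero unfolding bij_betw_def inj_on_def by (metis image_eqI zero_closed)
    also have "\<dots> \<longleftrightarrow> x \<in> ?J"
      using J.a_rcos_self[OF x] by (auto simp: J.a_rcos_const)
    finally show ?thesis .
  qed
  show thesis
    by (rule that[of "\<lambda>x. f (?J +> x)"]) (use img mult add ker in auto)
qed

text \<open>\<open>P\<close> enters through elementwise maximality: everything outside
  \<open>P\<close> is invertible modulo \<open>P\<close>. A nonzero element of \<open>R y\<close> is
  \<open>s y\<close> with \<open>s\<close> outside \<open>P\<close>, and multiplying it by an
  inverse of \<open>s\<close> modulo \<open>P\<close> returns \<open>y\<close>.\<close>

lemma (in cring) PIdl_minimal: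
  assumes P: "\<And>s. \<lbrakk>s \<in> carrier R; s \<notin> P\<rbrakk> \<Longrightarrow> \<exists>r\<in>carrier R. \<one> \<ominus> r \<otimes> s \<in> P"
    and y: "y \<in> carrier R" "y \<noteq> \<zero>" "\<And>p. p \<in> P \<Longrightarrow> p \<otimes> y = \<zero>"
  shows "minimal_ideal (PIdl y) R"
  unfolding minimal_ideal_def
proof (intro conjI allI impI)
  show "ideal (PIdl y) R" by (rule cgenideal_ideal[OF y(1)])
  show "PIdl y \<noteq> {\<zero>}" using cgenideal_self[OF y(1)] y(2) by auto
  fix I assume I: "ideal I R \<and> I \<subseteq> PIdl y"
  interpret I: ideal I R using I by simp
  show "I = {\<zero>} \<or> I = PIdl y"
  proof (rule disjCI)
    assume "I \<noteq> PIdl y"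
    show "I = {\<zero>}"
    proof (rule ccontr)
      assume "I \<noteq> {\<zero>}"
      then obtain w where w: "w \<in> I" "w \<noteq> \<zero>" by auto
      then obtain s where s: "s \<in> carrier R" "w = s \<otimes> y"
        using I by (auto simp: cgenideal_def)
      then have "s \<notin> P" using w y by auto
      then obtain r where r: "r \<in> carrier R" "\<one> \<ominus> r \<otimes> s \<in> P" using P s by blast
      have "y = (\<one> \<ominus> r \<otimes> s) \<otimes> y \<oplus> r \<otimes> (s \<otimes> y)"
        using r s y(1) by algebra
      also have "\<dots> = r \<otimes> w"
        using r s y by simp
      finally have "y = r \<otimes> w" .
      then have "y \<in> I" using w r by (simp add: I.I_l_closed)
      then have "PIdl y \<subseteq> I" by (rule cgenideal_minimal[OF I.is_ideal])
      then show False using I \<open>I \<noteq> PIdl y\<close> by blast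
    qed
  qed
qed

text \<open>A nonzero annihilator of a maximal ideal \<open>P\<close> lies in the socle, so it is the image of
  some \<open>z\<close> under \<open>R/J \<cong> Soc R\<close>, where \<open>J\<close> is the radical. The class of \<open>z\<close> modulo \<open>P\<close>
  determines it: if \<open>z \<in> P\<close> and \<open>P z \<subseteq> J\<close> then \<open>z\<^sup>2 \<in> J\<close>, so \<open>z \<in> J\<close>.\<close>

lemma frobenius_card_annihilator:
  fixes R (structure)
  assumes R: "finite_frobenius_cring R" and "ideal P R"
    and max: "\<And>s. \<lbrakk>s \<in> carrier R; s \<notin> P\<rbrakk> \<Longrightarrow> \<exists>r\<in>carrier R. \<one> \<ominus> r \<otimes> s \<in> P"
  shows "card {y \<in> carrier R. \<forall>p\<in>P. p \<otimes> y = \<zero>} * card P \<le> card (carrier R)"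
proof -
  interpret cring R using R by (simp add: finite_frobenius_cring_def)
  interpret P: ideal P R by fact
  interpret J: ideal "jacobson_radical R" R by (rule jacobson_radical_ideal)
  let ?N = "{y \<in> carrier R. \<forall>p\<in>P. p \<otimes> y = \<zero>}"
  obtain \<phi> where \<phi>: "\<phi> ` carrier R = socle R"
    and mult: "\<And>r x. \<lbrakk>r \<in> carrier R; x \<in> carrier R\<rbrakk> \<Longrightarrow> \<phi> (r \<otimes> x) = r \<otimes> \<phi> x"
    and add: "\<And>x y. \<lbrakk>x \<in> carrier R; y \<in> carrier R\<rbrakk> \<Longrightarrow> \<phi> (x \<oplus> y) = \<phi> x \<oplus> \<phi> y"
    and ker: "\<And>x. x \<in> carrier R \<Longrightarrow> \<phi> x = \<zero> \<longleftrightarrow> x \<in> jacobson_radical R"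
    using frobenius_socle_map[OF R] by metis
  have \<phi>_closed: "\<phi> x \<in> carrier R" if "x \<in> carrier R" for x
    using \<phi> socle_subset that by blast
  have \<phi>_zero: "\<phi> x = \<zero>" if x: "x \<in> P" and Px: "\<And>p. p \<in> P \<Longrightarrow> p \<otimes> \<phi> x = \<zero>" for x
  proof -
    have c: "x \<in> carrier R" using x by simp
    then have "\<phi> (x \<otimes> x) = \<zero>" using mult Px[OF x] by metis
    then have "x \<otimes> x \<in> jacobson_radical R" using ker[of "x \<otimes> x"] c by blast
    then have "x \<in> jacobson_radical R" using c by (rule jacobson_radical_square[rotated])
    then show ?thesis using ker[OF c] by blast
  qed
  define z where "z y = (SOME x. x \<in> carrier R \<and> \<phi> x = y)" for y
  have z: "z y \<in> carrier R \<and> \<phi> (z y) = y" if y: "y \<in> ?N" for y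
  proof -
    have "y \<in> socle R"
    proof (cases "y = \<zero>")
      case True
      have "\<phi> \<zero> = \<zero>" by (simp add: ker)
      then show ?thesis using True \<phi> by (metis image_eqI zero_closed)
    next
      case False
      then have "minimal_ideal (PIdl y) R"
        using y by (intro PIdl_minimal[of P] max) auto
      then show ?thesis
        using minimal_ideal_subset_socle cgenideal_self[of y] y by auto
    qed
    then have "\<exists>x. x \<in> carrier R \<and> \<phi> x = y" unfolding \<phi>[symmetric] by blast
    then show ?thesis unfolding z_def by (rule someI_ex)
  qed
  \<comment> \<open>The pairs list the elements of the cosets \<open>z y + P\<close>, where
    \<open>z\<close> picks a preimage under \<open>\<phi>\<close>. Injectivity makes these cosets
    disjoint, which bounds the number of \<open>y\<close> by \<open>|R/P|\<close> without forming
    the quotient.\<close>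
  have "inj_on (\<lambda>(y, p). z y \<oplus> p) (?N \<times> P)"
  proof (rule inj_onI, clarify)
    fix y p y' p'
    assume y: "y \<in> carrier R" "\<forall>p\<in>P. p \<otimes> y = \<zero>" and y': "y' \<in> carrier R" "\<forall>p\<in>P. p \<otimes> y' = \<zero>"
      and p: "p \<in> P" "p' \<in> P" and eq: "z y \<oplus> p = z y' \<oplus> p'"
    have c: "z y \<in> carrier R" "z y' \<in> carrier R" "\<phi> (z y) = y" "\<phi> (z y') = y'"
        "p \<in> carrier R" "p' \<in> carrier R"
      using z y y' p by auto
    \<comment> \<open>By \<open>eq\<close> this is also \<open>z y - z y'\<close>. It lies in
      \<open>P\<close> and its image \<open>y - y'\<close> is killed by \<open>P\<close>, so
      \<open>\<phi>_zero\<close> applies.\<close>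
    let ?w = "p' \<ominus> p"
    have w: "?w \<in> P" using p by (simp add: a_minus_def)
    have zw: "z y = z y' \<oplus> ?w"
    proof -
      have "z y = (z y \<oplus> p) \<ominus> p" using c(1,5) by algebra
      also have "\<dots> = z y' \<oplus> ?w" unfolding eq using c by algebra
      finally show ?thesis .
    qed
    have y_eq: "y = y' \<oplus> \<phi> ?w"
      using add[of "z y'" ?w] c zw by simp
    have "\<phi> ?w = \<zero>"
    proof (rule \<phi>_zero[OF w])
      fix q assume q: "q \<in> P"
      then have "q \<otimes> y = q \<otimes> y' \<oplus> q \<otimes> \<phi> ?w"
        unfolding y_eq using c y' by (simp add: r_distr \<phi>_closed)
      then show "q \<otimes> \<phi> ?w = \<zero>"
        using q y y' c by (simp add: \<phi>_closed)
    qed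
    then have "y = y'" using y_eq y' by simp
    then show "y = y' \<and> p = p'" using eq c by simp
  qed
  moreover have "(\<lambda>(y, p). z y \<oplus> p) ` (?N \<times> P) \<subseteq> carrier R"
    by (clarify, rule a_closed) (blast intro: z[THEN conjunct1] P.Icarr)+
  moreover have "finite (carrier R)"
    using R by (simp add: finite_frobenius_cring_def)
  ultimately have "card (?N \<times> P) \<le> card (carrier R)"
    by (rule card_inj_on_le)
  then show ?thesis by (simp add: card_cartesian_product)
qed


section \<open>Counting with bilinear pairings\<close>

text \<open>Differences with a chosen representative embed each fibre of \<open>f\<close> into
  \<open>K\<close>. The difference \<open>d\<close> is abstract because it is taken once between
  scalars and once between module elements.\<close>

lemma card_le_fibres:
  assumes "finite B" "finite K"
    and f: "\<And>x. x \<in> A \<Longrightarrow> f x \<in> B"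
    and d: "\<And>x z. \<lbrakk>x \<in> A; z \<in> A; f x = f z\<rbrakk> \<Longrightarrow> d x z \<in> K"
    and inj: "\<And>x y z. \<lbrakk>x \<in> A; y \<in> A; z \<in> A; f x = f z; f y = f z; d x z = d y z\<rbrakk> \<Longrightarrow> x = y"
  shows "card A \<le> card B * card K"
proof -
  define rep where "rep b = (SOME z. z \<in> A \<and> f z = b)" for b
  have rep: "rep (f x) \<in> A \<and> f (rep (f x)) = f x" if "x \<in> A" for x
    unfolding rep_def by (rule someI[of _ x]) (use that in auto)
  have "inj_on (\<lambda>x. (f x, d x (rep (f x)))) A"
  proof (rule inj_onI)
    fix x y
    assume xy: "x \<in> A" "y \<in> A" and eq: "(f x, d x (rep (f x))) = (f y, d y (rep (f y)))"
    then show "x = y"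
      using rep[OF xy(1)] by (intro inj[OF xy, of "rep (f x)"]) auto
  qed
  moreover have "(\<lambda>x. (f x, d x (rep (f x)))) ` A \<subseteq> B \<times> K"
    using f d rep by (auto simp del: split_paired_all)
  ultimately have "card A \<le> card (B \<times> K)"
    using assms(1,2) by (intro card_inj_on_le) auto
  then show ?thesis by (simp add: card_cartesian_product)
qed

section \<open>Adjoining one element to a submodule\<close>

definition adjoin :: "('a, 'b) ring_scheme \<Rightarrow> ('a, 'c, 'd) module_scheme \<Rightarrow> 'c set \<Rightarrow> 'c \<Rightarrow> 'c set"
where
  "adjoin R M K x = {k \<oplus>\<^bsub>M\<^esub> s \<odot>\<^bsub>M\<^esub> x | k s. k \<in> K \<and> s \<in> carrier R}"

context module
begin

lemma smult_minus_distr: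
  assumes "s \<in> carrier R" "s' \<in> carrier R" "x \<in> carrier M"
  shows "(s \<ominus> s') \<odot>\<^bsub>M\<^esub> x = s \<odot>\<^bsub>M\<^esub> x \<ominus>\<^bsub>M\<^esub> s' \<odot>\<^bsub>M\<^esub> x"
  using assms by (simp add: a_minus_def a_minus_def smult_l_distr smult_l_minus)

lemma submodule_diff:
  assumes "submodule K R M" "x \<in> K" "y \<in> K"
  shows "x \<ominus>\<^bsub>M\<^esub> y \<in> K"
  using submoduleE[OF assms(1)] assms(2,3) by (simp add: a_minus_def)

lemma submodule_zero:
  assumes "submodule K R M"
  shows "\<zero>\<^bsub>M\<^esub> \<in> K"
  using subgroup.one_closed[OF submodule.axioms(1)[OF assms]] by simp

lemma adjoin_submodule:
  assumes K: "submodule K R M" and x: "x \<in> carrier M"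
  shows "submodule (adjoin R M K x) R M"
proof (rule submoduleI)
  note Kc = subsetD[OF submoduleE(1)[OF K]]
  show "adjoin R M K x \<subseteq> carrier M"
    using x Kc by (auto simp: adjoin_def)
  have "\<zero>\<^bsub>M\<^esub> = \<zero>\<^bsub>M\<^esub> \<oplus>\<^bsub>M\<^esub> \<zero> \<odot>\<^bsub>M\<^esub> x" using x by (simp add: smult_l_null)
  then show "\<zero>\<^bsub>M\<^esub> \<in> adjoin R M K x"
    unfolding adjoin_def using submodule_zero[OF K] by blast
  fix u assume "u \<in> adjoin R M K x"
  then obtain k s where u: "u = k \<oplus>\<^bsub>M\<^esub> s \<odot>\<^bsub>M\<^esub> x" "k \<in> K" "s \<in> carrier R"
    by (auto simp: adjoin_def)
  have "\<ominus>\<^bsub>M\<^esub> u = \<ominus>\<^bsub>M\<^esub> k \<oplus>\<^bsub>M\<^esub> (\<ominus> s) \<odot>\<^bsub>M\<^esub> x"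
    using u x Kc by (simp add: M.minus_add smult_l_minus)
  then show "\<ominus>\<^bsub>M\<^esub> u \<in> adjoin R M K x"
    unfolding adjoin_def using u submoduleE(3)[OF K] R.a_inv_closed by blast
  {
    fix r assume r: "r \<in> carrier R"
    have "r \<odot>\<^bsub>M\<^esub> u = r \<odot>\<^bsub>M\<^esub> k \<oplus>\<^bsub>M\<^esub> (r \<otimes> s) \<odot>\<^bsub>M\<^esub> x"
      using u x r Kc by (simp add: smult_r_distr smult_assoc1)
    then show "r \<odot>\<^bsub>M\<^esub> u \<in> adjoin R M K x"
      unfolding adjoin_def using u submoduleE(4)[OF K] r R.m_closed by blast
  }
  fix w assume "w \<in> adjoin R M K x"
  then obtain k' s' where w: "w = k' \<oplus>\<^bsub>M\<^esub> s' \<odot>\<^bsub>M\<^esub> x" "k' \<in> K" "s' \<in> carrier R"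
    by (auto simp: adjoin_def)
  have "u \<oplus>\<^bsub>M\<^esub> w = (k \<oplus>\<^bsub>M\<^esub> k') \<oplus>\<^bsub>M\<^esub> (s \<oplus> s') \<odot>\<^bsub>M\<^esub> x"
    using u w x Kc by (simp add: smult_l_distr M.a_ac)
  then show "u \<oplus>\<^bsub>M\<^esub> w \<in> adjoin R M K x"
    unfolding adjoin_def using u w submoduleE(5)[OF K] R.a_closed by blast
qed

lemma subset_adjoin:
  assumes "submodule K R M" "x \<in> carrier M"
  shows "K \<subseteq> adjoin R M K x"
proof
  fix k assume "k \<in> K"
  then have "k = k \<oplus>\<^bsub>M\<^esub> \<zero> \<odot>\<^bsub>M\<^esub> x"
    using submoduleE(1)[OF assms(1)] assms(2) by (auto simp: smult_l_null)
  then show "k \<in> adjoin R M K x"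
    unfolding adjoin_def using \<open>k \<in> K\<close> R.zero_closed by blast
qed

lemma mem_adjoin:
  assumes "submodule K R M" "x \<in> carrier M"
  shows "x \<in> adjoin R M K x"
proof -
  have "x = \<zero>\<^bsub>M\<^esub> \<oplus>\<^bsub>M\<^esub> \<one> \<odot>\<^bsub>M\<^esub> x" using assms(2) by simp
  then show ?thesis
    unfolding adjoin_def using submodule_zero[OF assms(1)] R.one_closed by blast
qed

lemma adjoin_subset:
  assumes "submodule L R M" "K \<subseteq> L" "x \<in> L"
  shows "adjoin R M K x \<subseteq> L"
  using submoduleE(4,5)[OF assms(1)] assms(2,3) by (auto simp: adjoin_def)

text \<open>The annihilator of the class of \<open>x\<close> modulo \<open>K\<close>, usually
  written \<open>(K : x)\<close>. In the counting step it takes the place of the maximal ideal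
  \<open>P\<close>.\<close>

lemma colon_ideal:
  assumes K: "submodule K R M" and x: "x \<in> carrier M"
  shows "ideal {s \<in> carrier R. s \<odot>\<^bsub>M\<^esub> x \<in> K} R"
proof (rule idealI)
  show "ring R" by (rule R.ring_axioms)
  show "subgroup {s \<in> carrier R. s \<odot>\<^bsub>M\<^esub> x \<in> K} (add_monoid R)"
  proof (rule R.add.subgroupI)
    have "\<zero> \<odot>\<^bsub>M\<^esub> x \<in> K" using submodule_zero[OF K] x by (simp add: smult_l_null)
    then show "{s \<in> carrier R. s \<odot>\<^bsub>M\<^esub> x \<in> K} \<noteq> {}" by blast
  qed (use x submoduleE(3,5)[OF K] in \<open>auto simp: smult_l_distr smult_l_minus simp flip: a_inv_def\<close>)
next
  fix s r assume s: "s \<in> {s \<in> carrier R. s \<odot>\<^bsub>M\<^esub> x \<in> K}" and r: "r \<in> carrier R"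
  then show "r \<otimes> s \<in> {s \<in> carrier R. s \<odot>\<^bsub>M\<^esub> x \<in> K}"
    using x submoduleE(4)[OF K] by (auto simp: smult_assoc1)
  then show "s \<otimes> r \<in> {s \<in> carrier R. s \<odot>\<^bsub>M\<^esub> x \<in> K}"
    using s r by (simp add: R.m_comm)
qed

text \<open>Pairs \<open>(k, s)\<close> with the same value \<open>k + s x\<close> have scalars
  congruent modulo \<open>P = {s. s x \<in> K}\<close>, and the scalar then determines
  \<open>k\<close>. With the quotients cleared this reads
  \<open>|R/P| \<le> |(K + R x)/K|\<close>.\<close>

lemma card_adjoin:
  assumes K: "submodule K R M" and x: "x \<in> carrier M"
    and fin: "finite K" "finite (carrier R)"
  shows "card K * card (carrier R) \<le>
    card (adjoin R M K x) * card {s \<in> carrier R. s \<odot>\<^bsub>M\<^esub> x \<in> K}"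
proof -
  note Kc = subsetD[OF submoduleE(1)[OF K]]
  have "adjoin R M K x = (\<lambda>(k, s). k \<oplus>\<^bsub>M\<^esub> s \<odot>\<^bsub>M\<^esub> x) ` (K \<times> carrier R)"
    by (auto simp: adjoin_def)
  then have "finite (adjoin R M K x)" using fin by simp
  then have "card (K \<times> carrier R) \<le>
    card (adjoin R M K x) * card {s \<in> carrier R. s \<odot>\<^bsub>M\<^esub> x \<in> K}"
  proof (rule card_le_fibres[where f = "\<lambda>(k, s). k \<oplus>\<^bsub>M\<^esub> s \<odot>\<^bsub>M\<^esub> x"
        and d = "\<lambda>(k, s) (k', s'). s \<ominus> s'"], goal_cases)
    case 1
    then show ?case using fin by simp
  next
    case (2 p)
    then show ?case by (auto simp: adjoin_def)
  next
    case (3 p q)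
    obtain k s k' s' where pq: "p = (k, s)" "q = (k', s')" by fastforce
    have mem: "k \<in> K" "k' \<in> K" "s \<in> carrier R" "s' \<in> carrier R"
      and eq: "k \<oplus>\<^bsub>M\<^esub> s \<odot>\<^bsub>M\<^esub> x = k' \<oplus>\<^bsub>M\<^esub> s' \<odot>\<^bsub>M\<^esub> x"
      using 3 pq by auto
    have c: "k \<in> carrier M" "k' \<in> carrier M" "s \<odot>\<^bsub>M\<^esub> x \<in> carrier M" "s' \<odot>\<^bsub>M\<^esub> x \<in> carrier M"
      using mem Kc x by auto
    \<comment> \<open>Adding and subtracting \<open>k\<close> creates the left side of
      \<open>eq\<close>, which can then be replaced.\<close>
    have "(s \<ominus> s') \<odot>\<^bsub>M\<^esub> x = (k \<oplus>\<^bsub>M\<^esub> s \<odot>\<^bsub>M\<^esub> x) \<ominus>\<^bsub>M\<^esub> (k \<oplus>\<^bsub>M\<^esub> s' \<odot>\<^bsub>M\<^esub> x)"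
      unfolding smult_minus_distr[OF mem(3,4) x]
      using c by (simp add: a_minus_def M.minus_add M.a_ac M.r_neg M.r_neg1 M.r_neg2)
    also have "\<dots> = k' \<ominus>\<^bsub>M\<^esub> k"
      unfolding eq using c by (simp add: a_minus_def M.minus_add M.a_ac M.r_neg M.r_neg1 M.r_neg2)
    also have "\<dots> \<in> K" by (rule submodule_diff[OF K mem(2,1)])
    finally show ?case using mem pq by simp
  next
    case (4 p q r)
    obtain k s k' s' k'' s'' where pq: "p = (k, s)" "q = (k', s')" "r = (k'', s'')" by (metis surj_pair)
    have mem: "k \<in> K" "k' \<in> K" "s \<in> carrier R" "s' \<in> carrier R" "s'' \<in> carrier R"
      and eq: "k \<oplus>\<^bsub>M\<^esub> s \<odot>\<^bsub>M\<^esub> x = k' \<oplus>\<^bsub>M\<^esub> s' \<odot>\<^bsub>M\<^esub> x" "s \<ominus> s'' = s' \<ominus> s''"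
      using 4 pq by auto
    have "s = s'" using eq(2) mem by (simp add: a_minus_def)
    then show ?case using eq(1) mem Kc x pq by simp
  qed
  then show ?thesis by (simp add: card_cartesian_product)
qed

end

section \<open>Orthogonality for bilinear pairings over a Frobenius ring\<close>

locale frobenius_pairing =
  fixes R (structure) and M :: "('a, 'c, 'd) module_scheme" and N :: "('a, 'e, 'f) module_scheme"
    and B :: "'c \<Rightarrow> 'e \<Rightarrow> 'a"
  assumes frobenius: "finite_frobenius_cring R"
    and M: "module R M" "finite (carrier M)"
    and N: "module R N" "finite (carrier N)"
    and closed: "\<lbrakk>u \<in> carrier M; v \<in> carrier N\<rbrakk> \<Longrightarrow> B u v \<in> carrier R"
    and add_left: "\<lbrakk>u \<in> carrier M; u' \<in> carrier M; v \<in> carrier N\<rbrakk> \<Longrightarrow>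
      B (u \<oplus>\<^bsub>M\<^esub> u') v = B u v \<oplus> B u' v"
    and smult_left: "\<lbrakk>r \<in> carrier R; u \<in> carrier M; v \<in> carrier N\<rbrakk> \<Longrightarrow>
      B (r \<odot>\<^bsub>M\<^esub> u) v = r \<otimes> B u v"
    and add_right: "\<lbrakk>u \<in> carrier M; v \<in> carrier N; v' \<in> carrier N\<rbrakk> \<Longrightarrow>
      B u (v \<oplus>\<^bsub>N\<^esub> v') = B u v \<oplus> B u v'"
    and smult_right: "\<lbrakk>r \<in> carrier R; u \<in> carrier M; v \<in> carrier N\<rbrakk> \<Longrightarrow>
      B u (r \<odot>\<^bsub>N\<^esub> v) = r \<otimes> B u v"
begin

text \<open>The axioms are symmetric in \<open>M\<close> and \<open>N\<close>, so every bound on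
  \<open>perp\<close> has a mirror image on the other side.\<close>

lemma flip: "frobenius_pairing R N M (\<lambda>v u. B u v)"
  using frobenius M N closed add_left smult_left add_right smult_right
  by (intro frobenius_pairing.intro) auto

definition perp :: "'e set \<Rightarrow> 'c set \<Rightarrow> 'e set" where
  "perp D K = {v \<in> D. \<forall>u\<in>K. B u v = \<zero>}"

lemma minus_right:
  assumes "u \<in> carrier M" "v \<in> carrier N"
  shows "B u (\<ominus>\<^bsub>N\<^esub> v) = \<ominus> B u v"
proof -
  interpret N: module R N by (rule N)
  have "\<ominus>\<^bsub>N\<^esub> v = (\<ominus> \<one>) \<odot>\<^bsub>N\<^esub> v"
    using assms by (simp add: N.smult_l_minus)
  then show ?thesis
    using assms closed by (simp add: smult_right N.R.l_minus)
qed

lemma zero_right: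
  assumes "u \<in> carrier M"
  shows "B u \<zero>\<^bsub>N\<^esub> = \<zero>"
proof -
  interpret N: module R N by (rule N)
  show ?thesis
    using smult_right[of \<zero> u "\<zero>\<^bsub>N\<^esub>"] assms closed by (simp add: N.smult_l_null)
qed

lemma diff_right:
  assumes "u \<in> carrier M" "v \<in> carrier N" "w \<in> carrier N"
  shows "B u (v \<ominus>\<^bsub>N\<^esub> w) = B u v \<ominus> B u w"
proof -
  interpret N: module R N by (rule N)
  show ?thesis
    using assms by (simp add: a_minus_def add_right minus_right)
qed

text \<open>The map \<open>v \<mapsto> B x v\<close> takes values in the annihilator, because
  \<open>p (B x v) = B (p x) v = \<zero>\<close> when \<open>p x\<close> lies in \<open>K\<close>.
  Two elements with the same value differ by one that is orthogonal to both \<open>K\<close> and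
  \<open>x\<close>.\<close>

lemma card_perp_adjoin:
  assumes K: "submodule K R M" and D: "submodule D R N" and x: "x \<in> carrier M"
  shows "card (perp D K) \<le>
    card {y \<in> carrier R. \<forall>p\<in>{s \<in> carrier R. s \<odot>\<^bsub>M\<^esub> x \<in> K}. p \<otimes> y = \<zero>} *
    card (perp D (adjoin R M K x))"
proof -
  interpret M: module R M by (rule M)
  interpret N: module R N by (rule N)
  note Kc = subsetD[OF M.submoduleE(1)[OF K]]
  note Dc = subsetD[OF N.submoduleE(1)[OF D]]
  show ?thesis
  proof (rule card_le_fibres[where f = "B x" and d = "\<lambda>v w. v \<ominus>\<^bsub>N\<^esub> w"], goal_cases)
    case 1
    then show ?case using frobenius by (simp add: finite_frobenius_cring_def)
  next
    case 2
    then show ?case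
      using finite_subset[OF N.submoduleE(1)[OF D] N(2)] by (simp add: perp_def)
  next
    case (3 v)
    then have v: "v \<in> carrier N" "\<And>u. u \<in> K \<Longrightarrow> B u v = \<zero>" using Dc by (auto simp: perp_def)
    have "s \<otimes> B x v = \<zero>" if "s \<in> carrier R" "s \<odot>\<^bsub>M\<^esub> x \<in> K" for s
      using v that smult_left[OF that(1) x v(1)] by simp
    then show ?case using closed x v by simp
  next
    case (4 v w)
    then have vw: "v \<in> D" "v \<in> carrier N" "w \<in> D" "w \<in> carrier N" "B x v = B x w"
        "\<And>u. u \<in> K \<Longrightarrow> B u v = \<zero>" "\<And>u. u \<in> K \<Longrightarrow> B u w = \<zero>"
      using Dc by (auto simp: perp_def)
    have "B (k \<oplus>\<^bsub>M\<^esub> s \<odot>\<^bsub>M\<^esub> x) (v \<ominus>\<^bsub>N\<^esub> w) = \<zero>" if "k \<in> K" "s \<in> carrier R" for k s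
    proof -
      have c: "k \<in> carrier M" "v \<ominus>\<^bsub>N\<^esub> w \<in> carrier N" using that Kc vw by auto
      have "B k (v \<ominus>\<^bsub>N\<^esub> w) = \<zero>" "B x (v \<ominus>\<^bsub>N\<^esub> w) = \<zero>"
        using vw that c x closed by (simp_all add: diff_right) (simp_all add: a_minus_def M.R.r_neg)
      then show ?thesis
        using that c x by (simp add: add_left smult_left)
    qed
    then show ?case
      using N.submodule_diff[OF D vw(1,3)] by (auto simp: perp_def adjoin_def)
  next
    case (5 v w z)
    then have "v \<in> carrier N" "w \<in> carrier N" "z \<in> carrier N" using Dc by (auto simp: perp_def)
    then show ?case using 5(6) by (simp add: a_minus_def)
  qed
qed

text \<open>With \<open>P = {s. s x \<in> K}\<close>, passing to \<open>K + R x\<close> shrinks the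
  orthogonal part by at most the size of the annihilator of \<open>P\<close> and enlarges
  \<open>K\<close> by at least \<open>|R/P|\<close>. The hypothesis \<open>max\<close> allows
  \<open>frobenius_card_annihilator\<close> to compare the two factors.\<close>

lemma card_perp_step:
  assumes K: "submodule K R M" and D: "submodule D R N" and x: "x \<in> carrier M"
    and max: "\<And>s. \<lbrakk>s \<in> carrier R; s \<odot>\<^bsub>M\<^esub> x \<notin> K\<rbrakk> \<Longrightarrow>
      \<exists>r\<in>carrier R. (\<one> \<ominus> r \<otimes> s) \<odot>\<^bsub>M\<^esub> x \<in> K"
  shows "card (perp D K) * card K \<le>
    card (perp D (adjoin R M K x)) * card (adjoin R M K x)"
proof -
  interpret M: module R M by (rule M)
  let ?P = "{s \<in> carrier R. s \<odot>\<^bsub>M\<^esub> x \<in> K}"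
  let ?A = "{y \<in> carrier R. \<forall>p\<in>?P. p \<otimes> y = \<zero>}"
  let ?K' = "adjoin R M K x"
  have fin: "finite K" "finite (carrier R)"
    using finite_subset[OF M.submoduleE(1)[OF K] M(2)] frobenius
    by (auto simp: finite_frobenius_cring_def)
  have P: "ideal ?P R" by (rule M.colon_ideal[OF K x])
  have "\<zero> \<in> ?P" using P by (meson additive_subgroup.zero_closed ideal_def)
  \<comment> \<open>All bounds are multiplied by \<open>card ?P\<close>; positivity lets it be
    cancelled at the end.\<close>
  then have pos: "card ?P > 0" using fin by (auto simp: card_gt_0_iff)
  have "card ?A * card ?P \<le> card (carrier R)"
    by (rule frobenius_card_annihilator[OF frobenius P]) (use max in auto)
  then have "(card ?A * card ?P) * (card (perp D ?K') * card K) \<le>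
      card (carrier R) * (card (perp D ?K') * card K)"
    by (rule mult_right_mono) simp
  also have "\<dots> = card (perp D ?K') * (card K * card (carrier R))" by (simp only: ac_simps)
  also have "\<dots> \<le> card (perp D ?K') * (card ?K' * card ?P)"
    by (rule mult_left_mono[OF M.card_adjoin[OF K x fin]]) simp
  finally have "(card ?A * card (perp D ?K')) * (card K * card ?P) \<le>
      (card (perp D ?K') * card ?K') * card ?P"
    by (simp only: ac_simps)
  with mult_right_mono[OF card_perp_adjoin[OF K D x], of "card K * card ?P"]
  have "card (perp D K) * (card K * card ?P) \<le> (card (perp D ?K') * card ?K') * card ?P"
    using order.trans by blast
  then have "(card (perp D K) * card K) * card ?P \<le> (card (perp D ?K') * card ?K') * card ?P"
    by (simp only: mult.assoc)
  then show ?thesis using pos by (simp only: mult_le_cancel2)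
qed

text \<open>Adjoin to \<open>K\<close> an element \<open>x\<close> of \<open>L - K\<close> for which \<open>K + R x\<close> is as small as possible;
  then \<open>{s. s x \<in> K}\<close> is a maximal ideal.\<close>

lemma card_perp_mono:
  assumes "submodule K R M" and L: "submodule L R M" and D: "submodule D R N" and "K \<subseteq> L"
  shows "card (perp D K) * card K \<le> card (perp D L) * card L"
  using assms(1,4)
proof (induction "card L - card K" arbitrary: K rule: less_induct)
  case less
  interpret M: module R M by (rule M)
  note K = \<open>submodule K R M\<close>
  note Lc = subsetD[OF M.submoduleE(1)[OF L]]
  have finL: "finite L" using finite_subset[OF M.submoduleE(1)[OF L] M(2)] .
  show ?case
  proof (cases "K = L")
    case True
    then show ?thesis by simp
  next
    case False
    then obtain x\<^sub>0 where "x\<^sub>0 \<in> L - K" using less.prems by blast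
    from ex_has_least_nat[where P = "\<lambda>x. x \<in> L - K", OF this, of "\<lambda>x. card (adjoin R M K x)"]
    obtain x where x: "x \<in> L - K"
      and least: "\<And>y. y \<in> L - K \<Longrightarrow> card (adjoin R M K x) \<le> card (adjoin R M K y)"
      by blast
    let ?K' = "adjoin R M K x"
    have xc: "x \<in> carrier M" using x Lc by auto
    have K': "submodule ?K' R M" by (rule M.adjoin_submodule[OF K xc])
    have KK': "K \<subset> ?K'"
      using M.subset_adjoin[OF K xc] M.mem_adjoin[OF K xc] x by blast
    have K'L: "?K' \<subseteq> L"
      using x less.prems by (intro M.adjoin_subset[OF L]) auto
    have "card (perp D K) * card K \<le> card (perp D ?K') * card ?K'"
    proof (rule card_perp_step[OF K D xc])
      fix s assume s: "s \<in> carrier R" "s \<odot>\<^bsub>M\<^esub> x \<notin> K"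
      have sx: "s \<odot>\<^bsub>M\<^esub> x \<in> ?K'"
        using M.submoduleE(4)[OF K' s(1) M.mem_adjoin[OF K xc]] .
      then have "adjoin R M K (s \<odot>\<^bsub>M\<^esub> x) \<subseteq> ?K'"
        using KK' by (intro M.adjoin_subset[OF K']) auto
      moreover have "card ?K' \<le> card (adjoin R M K (s \<odot>\<^bsub>M\<^esub> x))"
        using sx s K'L by (intro least) auto
      \<comment> \<open>Minimality of \<open>card ?K'\<close> turns the inclusion into an equality.
        Then \<open>x = k + r s x\<close> for some \<open>k\<close> in \<open>K\<close>, so
        \<open>r\<close> inverts \<open>s\<close> modulo the colon ideal.\<close>
      ultimately have "adjoin R M K (s \<odot>\<^bsub>M\<^esub> x) = ?K'"
        using finite_subset[OF K'L finL] by (intro card_seteq) auto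
      then have "x \<in> adjoin R M K (s \<odot>\<^bsub>M\<^esub> x)" using M.mem_adjoin[OF K xc] by simp
      then obtain k r where kr: "k \<in> K" "r \<in> carrier R" "x = k \<oplus>\<^bsub>M\<^esub> r \<odot>\<^bsub>M\<^esub> (s \<odot>\<^bsub>M\<^esub> x)"
        by (auto simp: adjoin_def)
      have kc: "k \<in> carrier M" using kr M.submoduleE(1)[OF K] by blast
      have rsx: "r \<odot>\<^bsub>M\<^esub> (s \<odot>\<^bsub>M\<^esub> x) \<in> carrier M" using kr s xc by simp
      have "(\<one> \<ominus> r \<otimes> s) \<odot>\<^bsub>M\<^esub> x = x \<ominus>\<^bsub>M\<^esub> r \<odot>\<^bsub>M\<^esub> (s \<odot>\<^bsub>M\<^esub> x)"
        using s kr(2) xc by (simp add: M.smult_minus_distr M.smult_assoc1)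
      also have "\<dots> = (k \<oplus>\<^bsub>M\<^esub> r \<odot>\<^bsub>M\<^esub> (s \<odot>\<^bsub>M\<^esub> x)) \<ominus>\<^bsub>M\<^esub> r \<odot>\<^bsub>M\<^esub> (s \<odot>\<^bsub>M\<^esub> x)"
        using kr(3) by simp
      also have "\<dots> = k"
        using kc rsx by (simp add: a_minus_def M.M.a_assoc M.M.r_neg)
      finally show "\<exists>r\<in>carrier R. (\<one> \<ominus> r \<otimes> s) \<odot>\<^bsub>M\<^esub> x \<in> K" using kr by auto
    qed
    also have "\<dots> \<le> card (perp D L) * card L"
    proof (rule less.hyps[OF _ K' K'L])
      have "card K < card ?K'" "card ?K' \<le> card L"
        using KK' K'L finL by (auto intro: psubset_card_mono card_mono finite_subset)
      then show "card L - card ?K' < card L - card K" by linarith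
    qed
    finally show ?thesis .
  qed
qed

lemma perp_submodule:
  assumes D: "submodule D R N" and "K \<subseteq> carrier M"
  shows "submodule (perp D K) R N"
proof -
  interpret N: module R N by (rule N)
  note Dc = subsetD[OF N.submoduleE(1)[OF D]]
  have Kc: "u \<in> carrier M" if "u \<in> K" for u using assms(2) that by blast
  show ?thesis
  proof (rule N.submoduleI)
    show "perp D K \<subseteq> carrier N" using Dc by (auto simp: perp_def)
    show "\<zero>\<^bsub>N\<^esub> \<in> perp D K"
      using N.submodule_zero[OF D] zero_right Kc by (simp add: perp_def)
  next
    fix v assume "v \<in> perp D K"
    then have v: "v \<in> D" "v \<in> carrier N" "\<And>u. u \<in> K \<Longrightarrow> B u v = \<zero>"
      using Dc by (auto simp: perp_def)
    show "\<ominus>\<^bsub>N\<^esub> v \<in> perp D K"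
      using v Kc N.submoduleE(3)[OF D v(1)] by (simp add: perp_def minus_right)
    show "r \<odot>\<^bsub>N\<^esub> v \<in> perp D K" if "r \<in> carrier R" for r
      using v Kc N.submoduleE(4)[OF D that v(1)] that by (simp add: perp_def smult_right)
    fix w assume "w \<in> perp D K"
    then have w: "w \<in> D" "w \<in> carrier N" "\<And>u. u \<in> K \<Longrightarrow> B u w = \<zero>"
      using Dc by (auto simp: perp_def)
    show "v \<oplus>\<^bsub>N\<^esub> w \<in> perp D K"
      using v w Kc N.submoduleE(5)[OF D v(1) w(1)] by (simp add: perp_def add_right)
  qed
qed

text \<open>Apply monotonicity to \<open>C \<inter> D\<^sup>\<bottom> \<subseteq> C\<close>, where the left member is orthogonal to all of \<open>D\<close>.\<close>

lemma card_perp_le: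
  assumes C: "submodule C R M" and D: "submodule D R N"
  shows "card D * card {u \<in> C. \<forall>v\<in>D. B u v = \<zero>} \<le> card (perp D C) * card C"
proof -
  interpret M: module R M by (rule M)
  interpret N: module R N by (rule N)
  interpret flip: frobenius_pairing R N M "\<lambda>v u. B u v" by (rule flip)
  let ?K = "flip.perp C D"
  have K: "submodule ?K R M"
    by (rule flip.perp_submodule[OF C N.submoduleE(1)[OF D]])
  have "perp D ?K = D" by (auto simp: perp_def flip.perp_def)
  moreover have "?K \<subseteq> C" by (auto simp: flip.perp_def)
  ultimately have "card D * card ?K \<le> card (perp D C) * card C"
    using card_perp_mono[OF K C D] by simp
  then show ?thesis unfolding flip.perp_def .
qed

text \<open>One inequality is \<open>card_perp_le\<close>, the other is the same lemma for the
  flipped pairing.\<close>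

lemma card_perp:
  assumes C: "submodule C R M" and D: "submodule D R N"
  shows "card {v \<in> D. \<forall>u\<in>C. B u v = \<zero>} * card C = card D * card {u \<in> C. \<forall>v\<in>D. B u v = \<zero>}"
proof (rule antisym)
  interpret flip: frobenius_pairing R N M "\<lambda>v u. B u v" by (rule flip)
  show "card D * card {u \<in> C. \<forall>v\<in>D. B u v = \<zero>} \<le> card {v \<in> D. \<forall>u\<in>C. B u v = \<zero>} * card C"
    using card_perp_le[OF C D] unfolding perp_def .
  show "card {v \<in> D. \<forall>u\<in>C. B u v = \<zero>} * card C \<le> card D * card {u \<in> C. \<forall>v\<in>D. B u v = \<zero>}"
    using flip.card_perp_le[OF D C] unfolding flip.perp_def by (simp only: mult.commute)
qed

end

section \<open>Substitution into polynomials\<close>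

lemma mconst_0 [simp]: "mconst 0 = 0"
  by (simp add: mconst_def)

lemma mconst_1 [simp]: "mconst 1 = 1"
  by (simp add: mconst_def)

lemma mconst_add: "mconst (a + b) = mconst a + mconst b"
  by (simp add: mconst_def single_add)

lemma mconst_mult: "mconst (a * b) = mconst a * mconst b"
  by (simp add: mconst_def mult_single)

lemma mconst_sum: "mconst (sum f A) = (\<Sum>x\<in>A. mconst (f x))"
  by (induction A rule: infinite_finite_induct) (simp_all add: mconst_add)

lemma mconst_of_nat [simp]: "mconst (of_nat k) = of_nat k"
  by (induction k) (simp_all add: mconst_add)

text \<open>Cancellation can make the keys of a sum smaller than the union of the keys; summing over
  a common larger set makes additivity a termwise matter.\<close>

lemma subst_mat_supset:
  assumes "finite S" "Poly_Mapping.keys p \<subseteq> S"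
  shows "subst_mat p Y = (\<Sum>m\<in>S. mconst (Poly_Mapping.lookup p m) *
     (\<Prod>v\<in>Poly_Mapping.keys m. (Y $$ v) ^ Poly_Mapping.lookup m v))"
  unfolding subst_mat_def using assms
  by (intro sum.mono_neutral_left) (auto simp: in_keys_iff)

lemma subst_mat_0 [simp]: "subst_mat 0 Y = 0"
  by (simp add: subst_mat_def)

lemma subst_mat_add: "subst_mat (p + q) Y = subst_mat p Y + subst_mat q Y"
proof -
  let ?S = "Poly_Mapping.keys p \<union> Poly_Mapping.keys q"
  have "Poly_Mapping.keys (p + q) \<subseteq> ?S"
    by (rule Poly_Mapping.keys_add)
  then show ?thesis
    by (simp add: subst_mat_supset[of ?S] lookup_add mconst_add distrib_right sum.distrib)
qed

lemma subst_mat_sum: "subst_mat (sum f A) Y = (\<Sum>x\<in>A. subst_mat (f x) Y)"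
  by (induction A rule: infinite_finite_induct) (simp_all add: subst_mat_add)

lemma prod_indet:
  assumes "finite L"
  shows "(\<Prod>l\<in>L. indet (f l) l) =
    Poly_Mapping.single (\<Sum>l\<in>L. Poly_Mapping.single (f l, l) 1) 1"
  using assms
  by (induction L) (simp_all add: indet_def mult_single)

text \<open>One indeterminate per column gives a squarefree monomial with coefficient 1. The
  enumerators are sums of such monomials, so together with \<open>subst_mat_sum\<close> this
  evaluates them.\<close>

lemma subst_mat_prod_indet:
  assumes "finite L"
  shows "subst_mat (\<Prod>l\<in>L. indet (f l) l) Y = (\<Prod>l\<in>L. Y $$ (f l, l))"
proof -
  define m where "m = (\<Sum>l\<in>L. Poly_Mapping.single (f l, l) (1::nat))"
  have lookup: "Poly_Mapping.lookup m v = (if snd v \<in> L \<and> f (snd v) = fst v then 1 else 0)" for v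
  proof -
    have "Poly_Mapping.lookup m v = (\<Sum>l\<in>L. if l = snd v then (if f l = fst v then 1 else 0) else 0)"
      by (auto simp: m_def lookup_sum lookup_single when_def prod_eq_iff intro!: sum.cong)
    then show ?thesis using assms by (simp add: sum.delta)
  qed
  have keys: "Poly_Mapping.keys m = (\<lambda>l. (f l, l)) ` L"
    by (auto simp: in_keys_iff lookup simp del: One_nat_def split: if_splits)
  have "subst_mat (\<Prod>l\<in>L. indet (f l) l) Y =
      (\<Prod>v\<in>(\<lambda>l. (f l, l)) ` L. (Y $$ v) ^ Poly_Mapping.lookup m v)"
    unfolding prod_indet[OF assms] m_def[symmetric] by (simp add: subst_mat_def keys)
  also have "\<dots> = (\<Prod>l\<in>L. Y $$ (f l, l))"
    by (subst prod.reindex) (auto simp: inj_on_def lookup intro!: prod.cong)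
  finally show ?thesis .
qed

section \<open>The enumerator as a sum over codewords\<close>

text \<open>Needed for the index set of \<open>sse\<close>, since a \<open>sum\<close> over an
  infinite set is 0 by convention. A submultiset of \<open>add_mset x M\<close> either avoids
  \<open>x\<close> or arises from one of \<open>M\<close> by adding \<open>x\<close>.\<close>

lemma finite_submultisets: "finite {Z. Z \<subseteq># M}"
proof (induction M)
  case (add x M)
  have "{Z. Z \<subseteq># add_mset x M} \<subseteq> {Z. Z \<subseteq># M} \<union> add_mset x ` {Z. Z \<subseteq># M}"
  proof
    fix Z assume Z: "Z \<in> {Z. Z \<subseteq># add_mset x M}"
    show "Z \<in> {Z. Z \<subseteq># M} \<union> add_mset x ` {Z. Z \<subseteq># M}"
    proof (cases "x \<in># Z")
      case True
      then obtain Z' where "Z = add_mset x Z'" by (meson multi_member_split)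
      then show ?thesis using Z by auto
    next
      case False
      have "Z \<subseteq># M"
      proof (intro mset_subset_eqI)
        fix y
        show "count Z y \<le> count M y"
          using mset_subset_eq_count[of Z "add_mset x M" y] Z False
          by (cases "y = x") (auto simp: not_in_iff)
      qed
      then show ?thesis by simp
    qed
  qed
  then show ?case using add finite_subset by blast
qed simp

text \<open>Each codeword is counted by exactly one multiset, so exchanging the two sums leaves one
  monomial per codeword.\<close>

lemma sse_eq_sum_codewords:
  assumes "finite C"
    and idx: "\<And>c l. \<lbrakk>c \<in> C; l < n\<rbrakk> \<Longrightarrow> idx (c l) \<le> t"
    and idx_eq: "\<And>c l i. \<lbrakk>c \<in> C; l < n; i \<le> t\<rbrakk> \<Longrightarrow>
      PIdl\<^bsub>R\<^esub> (c l) = PIdl\<^bsub>R\<^esub> (a i) \<longleftrightarrow> idx (c l) = i"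
  shows "sse R a t n C = (\<Sum>c\<in>C. \<Prod>l<n. indet (idx (c l)) l :: 'k::comm_ring_1 mpoly)"
proof -
  let ?S = "{Z. Z \<subseteq># repeat_mset t (mset_set {..<n})}"
  let ?Q = "\<lambda>c Z. \<forall>i\<in>{0..t}. ideal_support R a n i c = mult_level n i Z"
  let ?T = "\<lambda>Z. \<Prod>i\<in>{0..t}. \<Prod>l\<in>mult_level n i Z. indet i l :: 'k mpoly"
  \<comment> \<open>The multiset belonging to \<open>c\<close>: column \<open>l\<close> has
    multiplicity \<open>idx (c l)\<close>. Index 0 means that \<open>l\<close> does not occur, which
    is why multiplicities up to \<open>t\<close> encode \<open>t + 1\<close> classes.\<close>
  define Z where "Z c = (\<Sum>l<n. replicate_mset (idx (c l)) l)" for c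
  have count_Z: "count (Z c) l = (if l < n then idx (c l) else 0)" for c l
    by (simp add: Z_def count_sum sum.delta)
  have Q_iff: "Y \<in> ?S \<and> ?Q c Y \<longleftrightarrow> Y = Z c" if c: "c \<in> C" for c Y
  proof
    assume Y: "Y \<in> ?S \<and> ?Q c Y"
    show "Y = Z c"
    proof (rule multiset_eqI)
      fix l
      show "count Y l = count (Z c) l"
      proof (cases "l < n")
        case True
        then have "l \<in> ideal_support R a n (idx (c l)) c"
          using idx_eq[OF c True idx[OF c True]] by (simp add: ideal_support_def)
        then have "l \<in> mult_level n (idx (c l)) Y"
          using Y idx[OF c True] by (metis atLeastAtMost_iff zero_le)
        then show ?thesis using True by (simp add: mult_level_def count_Z)
      next
        case False
        \<comment> \<open>Outside the \<open>n\<close> columns the levels say nothing; there the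
          bound by the ambient multiset forces multiplicity 0.\<close>
        have "count Y l \<le> count (repeat_mset t (mset_set {..<n})) l"
          by (rule mset_subset_eq_count) (use Y in simp)
        then show ?thesis using False by (simp add: count_Z)
      qed
    qed
  next
    assume Y: "Y = Z c"
    have "Z c \<subseteq># repeat_mset t (mset_set {..<n})"
      by (rule mset_subset_eqI) (use idx[OF c] in \<open>simp add: count_Z\<close>)
    moreover have "ideal_support R a n i c = mult_level n i (Z c)" if "i \<in> {0..t}" for i
      unfolding ideal_support_def mult_level_def
      by (rule Collect_cong) (use idx_eq[OF c] that in \<open>auto simp: count_Z\<close>)
    ultimately show "Y \<in> ?S \<and> ?Q c Y" using Y by simp
  qed
  have T: "?T (Z c) = (\<Prod>l<n. indet (idx (c l)) l)" if c: "c \<in> C" for c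
  proof -
    have "?T (Z c) = (\<Prod>i\<in>{0..t}. \<Prod>l\<in>{l \<in> {..<n}. idx (c l) = i}. indet (idx (c l)) l)"
      by (intro prod.cong) (auto simp: mult_level_def count_Z)
    also have "\<dots> = (\<Prod>l<n. indet (idx (c l)) l)"
      by (rule prod.group) (use idx[OF c] in auto)
    finally show ?thesis .
  qed
  have "sse R a t n C = (\<Sum>Y\<in>?S. \<Sum>c\<in>C. if ?Q c Y then ?T Y else 0)"
    using assms(1) by (simp add: sse_def support_count_def sum.If_cases Int_def)
  also have "\<dots> = (\<Sum>c\<in>C. \<Sum>Y\<in>?S. if ?Q c Y then ?T Y else 0)"
    by (rule sum.swap)
  also have "\<dots> = (\<Sum>c\<in>C. \<Prod>l<n. indet (idx (c l)) l)"
  proof (rule sum.cong)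
    fix c assume c: "c \<in> C"
    have "(\<Sum>Y\<in>?S. if ?Q c Y then ?T Y else 0) = (\<Sum>Y\<in>{Z c}. ?T Y)"
      using Q_iff[OF c] finite_submultisets
      by (intro sum.mono_neutral_cong_right) auto
    then show "(\<Sum>Y\<in>?S. if ?Q c Y then ?T Y else 0) = (\<Prod>l<n. indet (idx (c l)) l)"
      using T[OF c] by simp
  qed simp
  finally show ?thesis .
qed

text \<open>Expand the product over all choice functions \<open>\<phi>\<close>, exchange sums and
  collect the \<open>v\<close> that satisfy every chosen condition. It is applied with membership in
  ideals for the dual code and with annihilation of ideals for \<open>C\<close>.\<close>

lemma sum_prod_sum_if:
  fixes w :: "'l \<Rightarrow> 'j \<Rightarrow> 'k::comm_ring_1"
  assumes "finite S" "finite L" "finite J"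
  shows "(\<Sum>v\<in>S. \<Prod>l\<in>L. \<Sum>j\<in>J. if P v l j then w l j else 0) =
    (\<Sum>\<phi>\<in>L \<rightarrow>\<^sub>E J. of_nat (card {v \<in> S. \<forall>l\<in>L. P v l (\<phi> l)}) * (\<Prod>l\<in>L. w l (\<phi> l)))"
proof -
  have "(\<Sum>v\<in>S. \<Prod>l\<in>L. \<Sum>j\<in>J. if P v l j then w l j else 0) =
      (\<Sum>v\<in>S. \<Sum>\<phi>\<in>L \<rightarrow>\<^sub>E J. \<Prod>l\<in>L. if P v l (\<phi> l) then w l (\<phi> l) else 0)"
    using assms by (simp add: prod_sum_PiE)
  also have "\<dots> = (\<Sum>\<phi>\<in>L \<rightarrow>\<^sub>E J. \<Sum>v\<in>S. if \<forall>l\<in>L. P v l (\<phi> l) then \<Prod>l\<in>L. w l (\<phi> l) else 0)"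
    unfolding sum.swap[of _ S]
  proof (intro sum.cong refl)
    fix \<phi> v
    show "(\<Prod>l\<in>L. if P v l (\<phi> l) then w l (\<phi> l) else 0) =
        (if \<forall>l\<in>L. P v l (\<phi> l) then \<Prod>l\<in>L. w l (\<phi> l) else 0)"
      using assms(2) by (auto intro!: prod.cong prod_zero)
  qed
  also have "\<dots> = (\<Sum>\<phi>\<in>L \<rightarrow>\<^sub>E J. of_nat (card {v \<in> S. \<forall>l\<in>L. P v l (\<phi> l)}) * (\<Prod>l\<in>L. w l (\<phi> l)))"
    using assms(1) by (simp add: sum.If_cases Int_def)
  finally show ?thesis .
qed

section \<open>Codes and products of principal ideals\<close>

lemma module_free_module:
  fixes R (structure)
  assumes "cring R"
  shows "module R (free_module R n)"
proof -
  interpret cring R by fact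
  let ?F = "free_module R n"
  have "abelian_group ?F"
  proof (rule abelian_groupI)
    fix x assume x: "x \<in> carrier ?F"
    have "(\<lambda>l\<in>{..<n}. \<ominus> x l) \<oplus>\<^bsub>?F\<^esub> x = \<zero>\<^bsub>?F\<^esub>"
      using x by (auto simp: free_module_def fun_eq_iff l_neg PiE_iff)
    moreover have "(\<lambda>l\<in>{..<n}. \<ominus> x l) \<in> carrier ?F"
      using x by (auto simp: free_module_def)
    ultimately show "\<exists>y\<in>carrier ?F. y \<oplus>\<^bsub>?F\<^esub> x = \<zero>\<^bsub>?F\<^esub>" by blast
  qed (auto simp: free_module_def fun_eq_iff PiE_iff extensional_def a_ac)
  then show ?thesis
    by (intro moduleI cring_axioms)
      (auto simp: free_module_def fun_eq_iff PiE_iff extensional_def l_distr r_distr m_assoc)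
qed

lemma frobenius_pairing_dot:
  fixes R (structure)
  assumes "finite_frobenius_cring R"
  shows "frobenius_pairing R (free_module R n) (free_module R n)
    (\<lambda>u v. \<Oplus>l\<in>{..<n}. u l \<otimes> v l)"
proof -
  have R: "cring R" "finite (carrier R)" using assms by (simp_all add: finite_frobenius_cring_def)
  interpret cring R by (rule R)
  have fin: "finite (carrier (free_module R n))"
    using R by (simp add: free_module_def finite_PiE)
  have mem: "u l \<in> carrier R" if "u \<in> carrier (free_module R n)" "l \<in> {..<n}" for u l
    using that by (auto simp: free_module_def)
  have add: "(u \<oplus>\<^bsub>free_module R n\<^esub> v) l = u l \<oplus> v l" if "l \<in> {..<n}" for u v l
    using that by (simp add: free_module_def)
  have smult: "(r \<odot>\<^bsub>free_module R n\<^esub> v) l = r \<otimes> v l" if "l \<in> {..<n}" for r v l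
    using that by (simp add: free_module_def)
  show ?thesis
  proof (rule frobenius_pairing.intro[OF assms module_free_module[OF R(1)] fin module_free_module[OF R(1)] fin], goal_cases)
    case (1 u v)
    then show ?case using mem by (intro finsum_closed) auto
  next
    case (2 u u' v)
    have "(\<Oplus>l\<in>{..<n}. (u \<oplus>\<^bsub>free_module R n\<^esub> u') l \<otimes> v l) = (\<Oplus>l\<in>{..<n}. u l \<otimes> v l \<oplus> u' l \<otimes> v l)"
      using 2 mem by (intro finsum_cong') (auto simp: add l_distr)
    also have "\<dots> = (\<Oplus>l\<in>{..<n}. u l \<otimes> v l) \<oplus> (\<Oplus>l\<in>{..<n}. u' l \<otimes> v l)"
      using 2 mem by (intro finsum_addf) auto
    finally show ?case .
  next
    case (3 r u v)
    have "(\<Oplus>l\<in>{..<n}. (r \<odot>\<^bsub>free_module R n\<^esub> u) l \<otimes> v l) = (\<Oplus>l\<in>{..<n}. r \<otimes> (u l \<otimes> v l))"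
      using 3 mem by (intro finsum_cong') (auto simp: smult m_assoc)
    also have "\<dots> = r \<otimes> (\<Oplus>l\<in>{..<n}. u l \<otimes> v l)"
      using 3 mem by (intro finsum_rdistr[symmetric]) auto
    finally show ?case .
  next
    case (4 u v v')
    have "(\<Oplus>l\<in>{..<n}. u l \<otimes> (v \<oplus>\<^bsub>free_module R n\<^esub> v') l) = (\<Oplus>l\<in>{..<n}. u l \<otimes> v l \<oplus> u l \<otimes> v' l)"
      using 4 mem by (intro finsum_cong') (auto simp: add r_distr)
    also have "\<dots> = (\<Oplus>l\<in>{..<n}. u l \<otimes> v l) \<oplus> (\<Oplus>l\<in>{..<n}. u l \<otimes> v' l)"
      using 4 mem by (intro finsum_addf) auto
    finally show ?case .
  next
    case (5 r u v)
    have "(\<Oplus>l\<in>{..<n}. u l \<otimes> (r \<odot>\<^bsub>free_module R n\<^esub> v) l) = (\<Oplus>l\<in>{..<n}. r \<otimes> (u l \<otimes> v l))"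
      using 5 mem by (intro finsum_cong') (auto simp: smult m_lcomm)
    also have "\<dots> = r \<otimes> (\<Oplus>l\<in>{..<n}. u l \<otimes> v l)"
      using 5 mem by (intro finsum_rdistr[symmetric]) auto
    finally show ?case .
  qed
qed

lemma PiE_ideals_submodule:
  fixes R (structure)
  assumes "cring R" and I: "\<And>l. l < n \<Longrightarrow> ideal (I l) R"
  shows "submodule (Pi\<^sub>E {..<n} I) R (free_module R n)"
proof -
  interpret F: module R "free_module R n" by (rule module_free_module[OF assms(1)])
  have sub: "r \<in> carrier R" if "l < n" "r \<in> I l" for l r
    using ideal.Icarr[OF I[OF that(1)] that(2)] .
  have zero: "\<zero> \<in> I l" if "l < n" for l
    using additive_subgroup.zero_closed[OF ideal.axioms(1)[OF I[OF that]]] .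
  have add: "r \<oplus> s \<in> I l" if "l < n" "r \<in> I l" "s \<in> I l" for l r s
    using additive_subgroup.a_closed[OF ideal.axioms(1)[OF I[OF that(1)]] that(2,3)] .
  have mult: "r \<otimes> s \<in> I l" if "l < n" "r \<in> carrier R" "s \<in> I l" for l r s
    using ideal.I_l_closed[OF I[OF that(1)] that(3,2)] .
  have sc: "r \<odot>\<^bsub>free_module R n\<^esub> v \<in> Pi\<^sub>E {..<n} I"
    if "r \<in> carrier R" "v \<in> Pi\<^sub>E {..<n} I" for r v
    using that mult by (auto simp: free_module_def)
  show ?thesis
  proof (rule F.submoduleI)
    show le: "Pi\<^sub>E {..<n} I \<subseteq> carrier (free_module R n)"
      using sub by (auto simp: free_module_def)
    show "\<zero>\<^bsub>free_module R n\<^esub> \<in> Pi\<^sub>E {..<n} I"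
      using zero by (auto simp: free_module_def)
    fix v assume v: "v \<in> Pi\<^sub>E {..<n} I"
    show "r \<odot>\<^bsub>free_module R n\<^esub> v \<in> Pi\<^sub>E {..<n} I" if "r \<in> carrier R" for r
      using sc that v .
    \<comment> \<open>Additive inverses are not a field of the record, so they are reached through
      the scalar \<open>\<ominus> \<one>\<close>.\<close>
    have "\<ominus>\<^bsub>free_module R n\<^esub> v = (\<ominus> \<one>) \<odot>\<^bsub>free_module R n\<^esub> v"
      using v le by (auto simp: F.smult_l_minus)
    then show "\<ominus>\<^bsub>free_module R n\<^esub> v \<in> Pi\<^sub>E {..<n} I"
      using sc[OF _ v] by simp
    fix w assume w: "w \<in> Pi\<^sub>E {..<n} I"
    show "v \<oplus>\<^bsub>free_module R n\<^esub> w \<in> Pi\<^sub>E {..<n} I"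
      using v w by (auto simp: free_module_def intro!: add)
  qed
qed

text \<open>Each generator is a multiple of the other. Hence a row of the annihilator matrix,
  defined through \<open>a i\<close>, can be read off from any generator of the same ideal.\<close>

lemma (in cring) principal_annihilator_cong:
  assumes "b \<in> carrier R" "c \<in> carrier R" "PIdl b = PIdl c"
  shows "principal_annihilator R b = principal_annihilator R c"
proof -
  have "principal_annihilator R b \<subseteq> principal_annihilator R c"
    if bc: "b \<in> carrier R" "c \<in> carrier R" "PIdl b = PIdl c" for b c
  proof
    fix r assume r: "r \<in> principal_annihilator R b"
    have "c \<in> PIdl b" using cgenideal_self[OF bc(2)] bc(3) by simp
    then obtain s where "s \<in> carrier R" "c = s \<otimes> b" by (auto simp: cgenideal_def)
    then show "r \<in> principal_annihilator R c"
      using r bc by (simp add: principal_annihilator_def m_assoc)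
  qed
  from this[OF assms] this[OF assms(2,1) assms(3)[symmetric]] show ?thesis by blast
qed

text \<open>This is \<open>card_perp\<close> for the dot product and the product of the ideals
  \<open>I l\<close>. Orthogonality to that product splits into coordinates because it contains the
  vectors supported in a single coordinate.\<close>

lemma card_dual_code_ideals:
  fixes R (structure)
  assumes R: "finite_frobenius_cring R" and C: "linear_code R n C"
    and I: "\<And>l. l < n \<Longrightarrow> ideal (I l) R"
  shows "card {v \<in> dual_code R n C. \<forall>l<n. v l \<in> I l} * card C =
    (\<Prod>l<n. card (I l)) * card {u \<in> C. \<forall>l<n. I l \<subseteq> principal_annihilator R (u l)}"
proof -
  interpret cring R using R by (simp add: finite_frobenius_cring_def)
  interpret frobenius_pairing R "free_module R n" "free_module R n" "\<lambda>u v. \<Oplus>l\<in>{..<n}. u l \<otimes> v l"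
    by (rule frobenius_pairing_dot[OF R])
  let ?D = "Pi\<^sub>E {..<n} I"
  have D: "submodule ?D R (free_module R n)"
    by (rule PiE_ideals_submodule[OF cring_axioms I])
  have C': "submodule C R (free_module R n)"
    using C by (simp add: linear_code_def)
  have Ic: "r \<in> carrier R" if "l < n" "r \<in> I l" for l r
    using ideal.Icarr[OF I[OF that(1)] that(2)] .
  have uc: "u l \<in> carrier R" if "u \<in> C" "l < n" for u l
    using module.submoduleE(1)[OF M(1) C'] that by (auto simp: free_module_def)
  have dual: "{v \<in> dual_code R n C. \<forall>l<n. v l \<in> I l} =
      {v \<in> ?D. \<forall>u\<in>C. (\<Oplus>l\<in>{..<n}. u l \<otimes> v l) = \<zero>}"
    using Ic by (auto simp: dual_code_def free_module_def PiE_iff)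
  have "(\<forall>v\<in>?D. (\<Oplus>l\<in>{..<n}. u l \<otimes> v l) = \<zero>) \<longleftrightarrow>
      (\<forall>l<n. I l \<subseteq> principal_annihilator R (u l))" if u: "u \<in> C" for u
  proof
    assume "\<forall>l<n. I l \<subseteq> principal_annihilator R (u l)"
    then have "u l \<otimes> v l = \<zero>" if "v \<in> ?D" "l \<in> {..<n}" for v l
      using that by (auto simp: principal_annihilator_def)
    then show "\<forall>v\<in>?D. (\<Oplus>l\<in>{..<n}. u l \<otimes> v l) = \<zero>"
      by (auto intro!: add.finprod_one_eqI)
  next
    assume *: "\<forall>v\<in>?D. (\<Oplus>l\<in>{..<n}. u l \<otimes> v l) = \<zero>"
    show "\<forall>l<n. I l \<subseteq> principal_annihilator R (u l)"
    proof (intro allI impI subsetI)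
      fix l s assume l: "l < n" and s: "s \<in> I l"
      \<comment> \<open>Testing with \<open>s\<close> in coordinate \<open>l\<close> and zero
        elsewhere isolates the term \<open>u l \<otimes> s\<close>.\<close>
      let ?v = "\<lambda>m\<in>{..<n}. if l = m then s else \<zero>"
      have "\<zero> \<in> I m" if "m < n" for m
        using additive_subgroup.zero_closed[OF ideal.axioms(1)[OF I[OF that]]] .
      then have "?v \<in> ?D" using s by auto
      from *[rule_format, OF this] have "\<zero> = (\<Oplus>m\<in>{..<n}. u m \<otimes> ?v m)" ..
      also have "\<dots> = (\<Oplus>m\<in>{..<n}. if l = m then u m \<otimes> s else \<zero>)"
        using u uc Ic[OF l s] by (intro finsum_cong') auto
      also have "\<dots> = u l \<otimes> s"
        using l u uc Ic[OF l s] by (intro finsum_singleton) auto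
      finally show "s \<in> principal_annihilator R (u l)"
        using Ic[OF l s] by (simp add: principal_annihilator_def)
    qed
  qed
  then have orth: "{u \<in> C. \<forall>v\<in>?D. (\<Oplus>l\<in>{..<n}. u l \<otimes> v l) = \<zero>} =
      {u \<in> C. \<forall>l<n. I l \<subseteq> principal_annihilator R (u l)}"
    by (intro Collect_cong conj_cong refl)
  have prod: "card ?D = (\<Prod>l<n. card (I l))" by (simp add: card_PiE)
  show ?thesis using card_perp[OF C' D] unfolding dual orth prod .
qed

section \<open>The MacWilliams identity\<close>

text \<open>The zero ideal and the \<open>t\<close> nonzero principal ideals are
  \<open>t + 1\<close> in number, so \<open>t + 1\<close> distinct ones among them exhaust
  them.\<close>

lemma (in cring) principal_ideal_index:
  assumes "finite (carrier R)" "t = num_nonzero_principal_ideals R"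
    and a: "\<And>i. i \<in> {0..t} \<Longrightarrow> a i \<in> carrier R"
    and inj: "inj_on (\<lambda>i. PIdl (a i)) {0..t}"
    and c: "c \<in> carrier R"
  shows "\<exists>i\<in>{0..t}. PIdl (a i) = PIdl c"
proof -
  let ?S = "{PIdl c | c. c \<in> carrier R \<and> PIdl c \<noteq> {\<zero>}}"
  let ?A = "(\<lambda>i. PIdl (a i)) ` {0..t}"
  have "?S \<subseteq> (\<lambda>c. PIdl c) ` carrier R" by auto
  then have fin: "finite ?S" using assms(1) finite_subset by blast
  have sub: "?A \<subseteq> insert {\<zero>} ?S" using a by auto
  have "card ?A = t + 1" using card_image[OF inj] by simp
  also have "\<dots> = card (insert {\<zero>} ?S)"
    using fin by (simp add: assms(2) num_nonzero_principal_ideals_def)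
  finally have "?A = insert {\<zero>} ?S"
    using fin sub by (intro card_subset_eq) auto
  moreover have "PIdl c \<in> insert {\<zero>} ?S" using c by auto
  ultimately have "PIdl c \<in> ?A" by simp
  then show ?thesis by auto
qed

lemma index_mult_mat_sum:
  assumes "M \<in> carrier_mat m (t + 1)" "N \<in> carrier_mat (t + 1) k" "i < m" "l < k"
  shows "(M * N) $$ (i, l) = (\<Sum>j\<in>{0..t}. M $$ (i, j) * N $$ (j, l))"
  using assms by (auto simp: scalar_prod_def atLeastLessThanSuc_atLeastAtMost intro!: sum.cong)

theorem theorem15:
  fixes R :: "('a, 'b) ring_scheme"
    and a :: "nat \<Rightarrow> 'a"
    and n t :: nat
    and C :: "(nat \<Rightarrow> 'a) set"
  assumes "finite_frobenius_cring R"
    and "t = num_nonzero_principal_ideals R"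
    and "\<And>i. i \<in> {0..t} \<Longrightarrow> a i \<in> carrier R"
    and "inj_on (\<lambda>i. PIdl\<^bsub>R\<^esub> (a i)) {0..t}"
    and "linear_code R n C"
  shows "(sse R a t n (dual_code R n C) :: 'k::field_char_0 mpoly) =
    mconst (1 / of_nat (card C)) *
    subst_mat (sse R a t n C)
      (map_mat mconst (annihilator_mat R a t * card_mat R a t * inclusion_mat_inv R a t) *
       indet_mat (t + 1) n)"
proof -
  interpret cring R using assms(1) by (simp add: finite_frobenius_cring_def)
  have finR: "finite (carrier R)" using assms(1) by (simp add: finite_frobenius_cring_def)
  interpret F: module R "free_module R n" by (rule module_free_module[OF cring_axioms])
  note a = assms(3)
  let ?J = "{0..t}"
  let ?I = "\<lambda>i. PIdl\<^bsub>R\<^esub> (a i)"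
  let ?ann = "principal_annihilator R"
  let ?D = "dual_code R n C"
  define A where "A = (inclusion_mat R a t :: 'k mat)"
  define B where "B = (inclusion_mat_inv R a t :: 'k mat)"
  have B: "B \<in> carrier_mat (t + 1) (t + 1)" "A * B = 1\<^sub>m (t + 1)"
    unfolding A_def B_def by (rule inclusion_mat_inv[OF assms(4)])+
  have A: "A \<in> carrier_mat (t + 1) (t + 1)" by (simp add: A_def inclusion_mat_def)
  define Q where "Q = (annihilator_mat R a t :: 'k mat)"
  define D where "D = (card_mat R a t :: 'k mat)"
  have QD: "Q \<in> carrier_mat (t + 1) (t + 1)" "D \<in> carrier_mat (t + 1) (t + 1)"
    by (simp_all add: Q_def annihilator_mat_def D_def card_mat_def)
  \<comment> \<open>\<open>y l j\<close> is the \<open>(j, l)\<close> entry of \<open>B\<close>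
    times the matrix of indeterminates, with the column as first argument.\<close>
  define y where "y l j = (\<Sum>k\<in>?J. mconst (B $$ (j, k)) * indet k l :: 'k mpoly)" for l j
  define idx where "idx c = (SOME i. i \<in> ?J \<and> ?I i = PIdl\<^bsub>R\<^esub> c)" for c
  have idx: "idx c \<in> ?J \<and> ?I (idx c) = PIdl\<^bsub>R\<^esub> c" if "c \<in> carrier R" for c
    unfolding idx_def
    by (rule someI_ex) (use principal_ideal_index[OF finR assms(2-4) that] in blast)
  have idx_eq: "PIdl\<^bsub>R\<^esub> c = ?I i \<longleftrightarrow> idx c = i" if "c \<in> carrier R" "i \<le> t" for c i
    using idx[OF that(1)] that(2) assms(4) by (auto simp: inj_on_def)
  have Cc: "C \<subseteq> {..<n} \<rightarrow>\<^sub>E carrier R"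
    using F.submoduleE(1) assms(5) by (simp add: linear_code_def free_module_def)
  have Dc: "?D \<subseteq> {..<n} \<rightarrow>\<^sub>E carrier R"
    by (auto simp: dual_code_def free_module_def)
  have fin: "finite ({..<n} \<rightarrow>\<^sub>E carrier R)" using finR by (simp add: finite_PiE)
  have sse: "(sse R a t n S :: 'k mpoly) = (\<Sum>v\<in>S. \<Prod>l<n. indet (idx (v l)) l)"
    if S: "S \<subseteq> {..<n} \<rightarrow>\<^sub>E carrier R" for S
  proof (rule sse_eq_sum_codewords)
    show "finite S" by (rule finite_subset[OF S fin])
    have "v l \<in> carrier R" if "v \<in> S" "l < n" for v l using S that by auto
    then show "idx (v l) \<le> t" "i \<le> t \<Longrightarrow> PIdl\<^bsub>R\<^esub> (v l) = ?I i \<longleftrightarrow> idx (v l) = i"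
      if "v \<in> S" "l < n" for v l i
      using idx idx_eq that by auto
  qed

  txt \<open>The change of variables \<open>X = A Y\<close>: the variable of an element \<open>c\<close> becomes a sum of
    indicator functions of principal ideals.\<close>
  have indet: "indet (idx c) l = (\<Sum>j\<in>?J. if c \<in> ?I j then y l j else 0)" if c: "c \<in> carrier R" for c l
  proof -
    let ?i = "idx c"
    have i: "?i \<le> t" "?I ?i = PIdl\<^bsub>R\<^esub> c" using idx[OF c] by auto
    have AB: "(\<Sum>j\<in>?J. A $$ (?i, j) * B $$ (j, k)) = (if ?i = k then 1 else 0)" if k: "k \<in> ?J" for k
    proof -
      have "(\<Sum>j\<in>?J. A $$ (?i, j) * B $$ (j, k)) = (A * B) $$ (?i, k)"
        by (rule index_mult_mat_sum[symmetric]) (use i(1) k B(1) A in auto)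
      then show ?thesis using i(1) k by (simp add: B(2))
    qed
    have A_eq: "A $$ (?i, j) = (if c \<in> ?I j then 1 else 0)" if j: "j \<in> ?J" for j
    proof -
      \<comment> \<open>Row \<open>idx c\<close> of \<open>A\<close> thus becomes the indicator of
        the principal ideals that contain \<open>c\<close>.\<close>
      have "PIdl\<^bsub>R\<^esub> c \<subseteq> ?I j \<longleftrightarrow> c \<in> ?I j"
        using cgenideal_self[OF c] cgenideal_minimal[OF cgenideal_ideal[OF a[OF j]]] by blast
      then show ?thesis using i j by (simp add: A_def inclusion_mat_def)
    qed
    have "(\<Sum>j\<in>?J. if c \<in> ?I j then y l j else 0) = (\<Sum>j\<in>?J. mconst (A $$ (?i, j)) * y l j)"
      by (rule sum.cong) (simp_all add: A_eq)
    also have "\<dots> = (\<Sum>k\<in>?J. mconst (\<Sum>j\<in>?J. A $$ (?i, j) * B $$ (j, k)) * indet k l)"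
      unfolding y_def sum_distrib_left mconst_sum sum_distrib_right mconst_mult
      by (subst sum.swap) (simp only: mult.assoc)
    also have "\<dots> = (\<Sum>k\<in>?J. if ?i = k then indet k l else 0)"
      by (rule sum.cong) (simp_all add: AB)
    also have "\<dots> = indet ?i l" using i(1) by (simp add: sum.delta')
    finally show ?thesis ..
  qed

  let ?Y = "map_mat mconst (Q * D * B) * indet_mat (t + 1) n :: 'k mpoly mat"
  \<comment> \<open>\<open>Q\<close> selects the ideals annihilated by \<open>c\<close>,
    \<open>D\<close> weights each of them with its size, and \<open>B\<close> has been absorbed into
    \<open>y\<close>.\<close>
  have Y: "?Y $$ (idx c, l) =
      (\<Sum>j\<in>?J. if ?I j \<subseteq> ?ann c then of_nat (card (?I j)) * y l j else 0)"
    if c: "c \<in> carrier R" and l: "l < n" for c l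
  proof -
    let ?i = "idx c"
    have i: "?i \<le> t" "?I ?i = PIdl\<^bsub>R\<^esub> c" using idx[OF c] by auto
    have ann: "?ann (a ?i) = ?ann c"
      using a i c by (intro principal_annihilator_cong) auto
    let ?q = "\<lambda>j. if ?I j \<subseteq> ?ann c then of_nat (card (?I j)) else 0 :: 'k"
    have QD_eq: "(Q * D) $$ (?i, j) = ?q j" if j: "j \<in> ?J" for j
    proof -
      have "(Q * D) $$ (?i, j) = (\<Sum>k\<in>?J. Q $$ (?i, k) * D $$ (k, j))"
        by (rule index_mult_mat_sum) (use i(1) j QD in auto)
      also have "\<dots> = (\<Sum>k\<in>?J. if k = j then ?q j else 0)"
        using i(1) j by (intro sum.cong) (auto simp: Q_def D_def annihilator_mat_def card_mat_def ann)
      finally show ?thesis using j by (simp add: sum.delta)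
    qed
    have QDB: "(Q * D * B) $$ (?i, k) = (\<Sum>j\<in>?J. ?q j * B $$ (j, k))" if k: "k \<in> ?J" for k
    proof -
      have "(Q * D * B) $$ (?i, k) = (\<Sum>j\<in>?J. (Q * D) $$ (?i, j) * B $$ (j, k))"
        by (rule index_mult_mat_sum) (use i(1) k QD B(1) in auto)
      also have "\<dots> = (\<Sum>j\<in>?J. ?q j * B $$ (j, k))"
        by (rule sum.cong) (simp_all only: QD_eq)
      finally show ?thesis .
    qed
    have "?Y $$ (?i, l) =
        (\<Sum>k\<in>?J. map_mat mconst (Q * D * B) $$ (?i, k) * indet_mat (t + 1) n $$ (k, l))"
      by (rule index_mult_mat_sum[where k = n]) (use i(1) l QD B(1) in \<open>auto simp: indet_mat_def\<close>)
    also have "\<dots> = (\<Sum>k\<in>?J. mconst ((Q * D * B) $$ (?i, k)) * indet k l)"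
      using i(1) l QD B(1) by (intro sum.cong) (auto simp: indet_mat_def simp del: index_mult_mat(1))
    also have "\<dots> = (\<Sum>k\<in>?J. mconst (\<Sum>j\<in>?J. ?q j * B $$ (j, k)) * indet k l)"
      by (rule sum.cong) (simp_all only: QDB)
    also have "\<dots> = (\<Sum>j\<in>?J. mconst (?q j) * y l j)"
      unfolding y_def sum_distrib_left mconst_sum sum_distrib_right mconst_mult
      by (subst sum.swap) (simp only: mult.assoc)
    also have "\<dots> = (\<Sum>j\<in>?J. if ?I j \<subseteq> ?ann c then of_nat (card (?I j)) * y l j else 0)"
      by (rule sum.cong) simp_all
    finally show ?thesis .
  qed

  \<comment> \<open>A choice function picks a principal ideal in every coordinate. \<open>?N\<close>
    counts the words of the dual code in the resulting product, \<open>?N'\<close> the words of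
    \<open>C\<close> orthogonal to it.\<close>
  let ?\<Phi> = "{..<n} \<rightarrow>\<^sub>E ?J"
  let ?N = "\<lambda>\<phi>. card {v \<in> ?D. \<forall>l\<in>{..<n}. v l \<in> ?I (\<phi> l)}"
  let ?N' = "\<lambda>\<phi>. card {u \<in> C. \<forall>l\<in>{..<n}. ?I (\<phi> l) \<subseteq> ?ann (u l)}"
  \<comment> \<open>A submodule is nonempty and \<open>C\<close> is finite, so its size is a nonzero
    natural number and stays nonzero in characteristic 0.\<close>
  have C0: "(of_nat (card C) :: 'k) \<noteq> 0"
    using F.submoduleE(2) assms(5) finite_subset[OF Cc fin] by (auto simp: linear_code_def)
  have div: "x = 1 / c * z" if "x * c = z" "c \<noteq> 0" for x c z :: 'k
    using that by auto
  \<comment> \<open>\<open>card_dual_code_ideals\<close> divided by \<open>card C\<close> in the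
    field and carried over to constant polynomials.\<close>
  have count: "of_nat (?N \<phi>) = mconst (1 / of_nat (card C)) *
      (of_nat (?N' \<phi>) * (\<Prod>l<n. of_nat (card (?I (\<phi> l)))) :: 'k mpoly)" if \<phi>: "\<phi> \<in> ?\<Phi>" for \<phi>
  proof -
    have "ideal (?I (\<phi> l)) R" if "l < n" for l
      using PiE_mem[OF \<phi>, of l] that by (intro cgenideal_ideal a) simp
    from card_dual_code_ideals[OF assms(1,5) this]
    have "?N \<phi> * card C = (\<Prod>l<n. card (?I (\<phi> l))) * ?N' \<phi>"
      by (simp only: Ball_def lessThan_iff)
    then have "(of_nat (?N \<phi>) * of_nat (card C) :: 'k) = of_nat ((\<Prod>l<n. card (?I (\<phi> l))) * ?N' \<phi>)"
      by (metis (no_types) of_nat_mult)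
    then have "(of_nat (?N \<phi>) :: 'k) =
        1 / of_nat (card C) * of_nat ((\<Prod>l<n. card (?I (\<phi> l))) * ?N' \<phi>)"
      by (rule div) (rule C0)
    then have "mconst (of_nat (?N \<phi>) :: 'k) =
        mconst (1 / of_nat (card C)) * mconst (of_nat ((\<Prod>l<n. card (?I (\<phi> l))) * ?N' \<phi>))"
      by (simp only: mconst_mult)
    then show ?thesis
      unfolding mconst_of_nat by (simp only: of_nat_mult of_nat_prod mult.commute)
  qed
  have "sse R a t n ?D = (\<Sum>v\<in>?D. \<Prod>l<n. \<Sum>j\<in>?J. if v l \<in> ?I j then y l j else 0)"
    unfolding sse[OF Dc] using Dc by (intro sum.cong prod.cong indet) auto
  also have "\<dots> = (\<Sum>\<phi>\<in>?\<Phi>. of_nat (?N \<phi>) * (\<Prod>l<n. y l (\<phi> l)))"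
    by (rule sum_prod_sum_if) (use finite_subset[OF Dc fin] in auto)
  also have "\<dots> = mconst (1 / of_nat (card C)) *
      (\<Sum>\<phi>\<in>?\<Phi>. of_nat (?N' \<phi>) * (\<Prod>l<n. of_nat (card (?I (\<phi> l))) * y l (\<phi> l)))"
    unfolding sum_distrib_left prod.distrib
    by (rule sum.cong) (simp_all only: count mult.assoc)
  \<comment> \<open>The expansion is now read backwards, with the sizes of the ideals moved into the
    weights.\<close>
  also have "(\<Sum>\<phi>\<in>?\<Phi>. of_nat (?N' \<phi>) * (\<Prod>l<n. of_nat (card (?I (\<phi> l))) * y l (\<phi> l))) =
      (\<Sum>u\<in>C. \<Prod>l<n. \<Sum>j\<in>?J. if ?I j \<subseteq> ?ann (u l) then of_nat (card (?I j)) * y l j else 0)"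
    by (rule sum_prod_sum_if[symmetric]) (use finite_subset[OF Cc fin] in auto)
  also have "\<dots> = (\<Sum>u\<in>C. \<Prod>l<n. ?Y $$ (idx (u l), l))"
    using Cc by (intro sum.cong prod.cong Y[symmetric]) auto
  also have "\<dots> = subst_mat (sse R a t n C) ?Y"
    unfolding sse[OF Cc] subst_mat_sum by (simp add: subst_mat_prod_indet)
  finally show ?thesis unfolding B_def Q_def D_def .
qed

end
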